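(* For generic $x_0,x_1,\dots,x_L$ (and $1\le i\le L$), \[ Z(X)=\det(W)\prod_{k=1}^L\frac{b(x_0-x_k)}{b(x_0-\mu_k)},\qquad Z(X_i^0)=\det(W_i)\prod_{k=1}^L\frac{b(x_0-x_k)}{b(x_0-\mu_k)}, \] where $W$ and $W_i$ are $L\times L$ matrices with, for $1\le\alpha,\beta\le L$, \[ W_{\alpha,\beta}=\begin{cases}\displaystyle\prod_{k=1}^La(x_\alpha-\mu_k)-\prod_{k=1}^Lb(x_\alpha-\mu_k)\prod_{\substack{k=0\\k\ne\alpha}}^L\frac{a(x_\alpha-x_k)}{b(x_\alpha-x_k)}&\beta=\alpha,\\[2ex] \dfrac{c(x_\alpha-x_\beta)}{b(x_\alpha-x_\beta)}\displaystyle\prod_{k=1}^Lb(x_\beta-\mu_k)\prod_{\substack{k=0\\k\ne\alpha,\beta}}^L\frac{a(x_\beta-x_k)}{b(x_\beta-x_k)}&\beta\ne\alpha,\end{cases} \] and $W_i$ equals $W$ except that its column $i$ is replaced by the column with entries \[ (W_i)_{\alpha,i}=\frac{c(x_0-x_\alpha)}{b(x_0-x_\alpha)}\prod_{k=1}^Lb(x_0-\mu_k)\prod_{\substack{k=1\\k\ne\alpha}}^L\frac{a(x_0-x_k)}{b(x_0-x_k)},\qquad1\le\alpha\le L. \] In particular the right-hand side of the first formula is independent of $x_0$.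
   Context: Six-vertex setup. Fix $\gamma\in\mathbb C$, $L\ge1$ and $\mu_1,\dots,\mu_L\in\mathbb C$. Let $a(x)=\sinh(x+\gamma)$, $b(x)=\sinh x$, $c(x)=\sinh\gamma$ (constant). With $v_1,v_2$ the standard basis of $\mathbb C^2$, let $R(x)$ be the matrix on $\mathbb C^2\otimes\mathbb C^2$ which in the ordered basis $v_1\otimes v_1,v_1\otimes v_2,v_2\otimes v_1,v_2\otimes v_2$ is $\begin{pmatrix}a(x)&0&0&0\\0&b(x)&c(x)&0\\0&c(x)&b(x)&0\\0&0&0&a(x)\end{pmatrix}$. On $\mathbb C^2_0\otimes(\mathbb C^2)^{\otimes L}$, let $T_0(x)=R_{01}(x-\mu_1)R_{02}(x-\mu_2)\cdots R_{0L}(x-\mu_L)$ (with $R_{0i}$ acting on the auxiliary factor $0$ and quantum factor $i$), written in the auxiliary space as $\begin{pmatrix}A(x)&B(x)\\C(x)&D(x)\end{pmatrix}$. With $|0\rangle=v_1^{\otimes L}$ and $\langle\bar0|=(v_2^* )^{\otimes L}$, the partition function of the six-vertex model with domain-wall boundaries is $Z(x_1,\dots,x_L)=\langle\bar0|B(x_1)B(x_2)\cdots B(x_L)|0\rangle$. Notation: $X=(x_1,\dots,x_L)$; for $1\le i\le L$, $X_i^0$ is $X$ with $x_i$ replaced by $x_0$. *)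

theory Defs
  imports Complex_Main "Jordan_Normal_Form.Determinant"
begin

definition wa :: "complex \<Rightarrow> complex \<Rightarrow> complex" where "wa \<gamma> x = sinh (x + \<gamma>)"
definition wb :: "complex \<Rightarrow> complex" where "wb x = sinh x"
definition wc :: "complex \<Rightarrow> complex \<Rightarrow> complex" where "wc \<gamma> x = sinh \<gamma>"

text \<open>Basis vectors v1, v2 are indexed by 1 and 2. The R-matrix entry
  R(x)[(a,s),(a',s')] is the coefficient of v_a \<otimes> v_s in R(x)(v_a' \<otimes> v_s').\<close>
definition Rmat :: "complex \<Rightarrow> complex \<Rightarrow> nat \<times> nat \<Rightarrow> nat \<times> nat \<Rightarrow> complex" where
  "Rmat \<gamma> x r c = (case (r, c) of ((a, s), (a', s')) \<Rightarrow>
     if a = a' \<and> s = s' then (if a = s then wa \<gamma> x else wb x)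
     else if a = s' \<and> s = a' \<and> a \<noteq> s then wc \<gamma> x else 0)"

text \<open>Basis of the quantum space (C^2)^{\<otimes>L}: words of length L over {1,2}
  (entry j-1 is the index of tensor factor j).\<close>
definition qbasis :: "nat \<Rightarrow> nat list set" where
  "qbasis L = {\<sigma>. length \<sigma> = L \<and> set \<sigma> \<subseteq> {1, 2}}"

text \<open>Basis of auxiliary space C^2_0 tensor the quantum space.\<close>
definition fbasis :: "nat \<Rightarrow> (nat \<times> nat list) set" where
  "fbasis L = {1, 2} \<times> qbasis L"

text \<open>Operators are represented by their matrices (row index, column index).\<close>
definition opmul :: "'i set \<Rightarrow> ('i \<Rightarrow> 'i \<Rightarrow> complex) \<Rightarrow> ('i \<Rightarrow> 'i \<Rightarrow> complex) \<Rightarrow> 'i \<Rightarrow> 'i \<Rightarrow> complex" where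
  "opmul S M N = (\<lambda>r c. \<Sum>k\<in>S. M r k * N k c)"

definition opid :: "'i \<Rightarrow> 'i \<Rightarrow> complex" where
  "opid = (\<lambda>r c. if r = c then 1 else 0)"

definition R0i :: "complex \<Rightarrow> nat \<Rightarrow> nat \<Rightarrow> complex \<Rightarrow> nat \<times> nat list \<Rightarrow> nat \<times> nat list \<Rightarrow> complex" where
  "R0i \<gamma> L i x r c = (case (r, c) of ((a, \<sigma>), (a', \<sigma>')) \<Rightarrow>
     Rmat \<gamma> x (a, \<sigma> ! (i - 1)) (a', \<sigma>' ! (i - 1)) *
     (if (\<forall>j<L. j \<noteq> i - 1 \<longrightarrow> \<sigma> ! j = \<sigma>' ! j) then 1 else 0))"

definition monodromy :: "complex \<Rightarrow> (nat \<Rightarrow> complex) \<Rightarrow> nat \<Rightarrow> complex \<Rightarrow> nat \<times> nat list \<Rightarrow> nat \<times> nat list \<Rightarrow> complex" where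
  "monodromy \<gamma> \<mu> L x =
     foldr (\<lambda>i M. opmul (fbasis L) (R0i \<gamma> L i (x - \<mu> i)) M) [1..<L+1] opid"

definition Bop :: "complex \<Rightarrow> (nat \<Rightarrow> complex) \<Rightarrow> nat \<Rightarrow> complex \<Rightarrow> nat list \<Rightarrow> nat list \<Rightarrow> complex" where
  "Bop \<gamma> \<mu> L x \<sigma> \<sigma>' = monodromy \<gamma> \<mu> L x (1, \<sigma>) (2, \<sigma>')"

text \<open>Domain-wall partition function Z(x_1,...,x_L) = <bar0| B(x_1)...B(x_L) |0>,
  with <bar0| = (v2^*)^{\<otimes>L} and |0> = v1^{\<otimes>L}.\<close>
definition Zdw :: "complex \<Rightarrow> (nat \<Rightarrow> complex) \<Rightarrow> nat \<Rightarrow> (nat \<Rightarrow> complex) \<Rightarrow> complex" where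
  "Zdw \<gamma> \<mu> L x =
     foldr (\<lambda>j M. opmul (qbasis L) (Bop \<gamma> \<mu> L (x j)) M) [1..<L+1] opid
       (replicate L 2) (replicate L 1)"

definition Wentry :: "complex \<Rightarrow> (nat \<Rightarrow> complex) \<Rightarrow> nat \<Rightarrow> (nat \<Rightarrow> complex) \<Rightarrow> nat \<Rightarrow> nat \<Rightarrow> complex" where
  "Wentry \<gamma> \<mu> L x \<alpha> \<beta> =
     (if \<beta> = \<alpha> then
        (\<Prod>k\<in>{1..L}. wa \<gamma> (x \<alpha> - \<mu> k))
        - (\<Prod>k\<in>{1..L}. wb (x \<alpha> - \<mu> k))
          * (\<Prod>k\<in>{0..L} - {\<alpha>}. wa \<gamma> (x \<alpha> - x k) / wb (x \<alpha> - x k))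
      else
        wc \<gamma> (x \<alpha> - x \<beta>) / wb (x \<alpha> - x \<beta>)
          * (\<Prod>k\<in>{1..L}. wb (x \<beta> - \<mu> k))
          * (\<Prod>k\<in>{0..L} - {\<alpha>, \<beta>}. wa \<gamma> (x \<beta> - x k) / wb (x \<beta> - x k)))"

definition Wcol :: "complex \<Rightarrow> (nat \<Rightarrow> complex) \<Rightarrow> nat \<Rightarrow> (nat \<Rightarrow> complex) \<Rightarrow> nat \<Rightarrow> complex" where
  "Wcol \<gamma> \<mu> L x \<alpha> =
     wc \<gamma> (x 0 - x \<alpha>) / wb (x 0 - x \<alpha>)
       * (\<Prod>k\<in>{1..L}. wb (x 0 - \<mu> k))
       * (\<Prod>k\<in>{1..L} - {\<alpha>}. wa \<gamma> (x 0 - x k) / wb (x 0 - x k))"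

definition Wmat :: "complex \<Rightarrow> (nat \<Rightarrow> complex) \<Rightarrow> nat \<Rightarrow> (nat \<Rightarrow> complex) \<Rightarrow> complex mat" where
  "Wmat \<gamma> \<mu> L x = mat L L (\<lambda>(r, s). Wentry \<gamma> \<mu> L x (r + 1) (s + 1))"

definition Wimat :: "complex \<Rightarrow> (nat \<Rightarrow> complex) \<Rightarrow> nat \<Rightarrow> (nat \<Rightarrow> complex) \<Rightarrow> nat \<Rightarrow> complex mat" where
  "Wimat \<gamma> \<mu> L x i = mat L L (\<lambda>(r, s).
     if s + 1 = i then Wcol \<gamma> \<mu> L x (r + 1) else Wentry \<gamma> \<mu> L x (r + 1) (s + 1))"

end

theory Submission
  imports Defs
begin

text \<open>
  Expanding \<open>det W\<close> along its diagonal and evaluating the principal minors of a Cauchy matrix turns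
  the first formula, multiplied by \<open>\<Prod>\<^sub>k b(x\<^sub>0 - \<mu>\<^sub>k)\<close>, into a sum over subsets \<open>S\<close> of the variables with
  summand \<open>(-1)\<^bsup>|S|\<^esup> \<Prod>\<^bsub>\<alpha>\<notin>S\<^esub> b(x\<^sub>0 - x\<^sub>\<alpha>) \<Prod>\<^sub>k a(x\<^sub>\<alpha> - \<mu>\<^sub>k) \<Prod>\<^bsub>\<beta>\<in>S\<^esub> b(x\<^sub>0 - x\<^sub>\<beta> - \<gamma>) \<Prod>\<^sub>k b(x\<^sub>\<beta> - \<mu>\<^sub>k)
  \<Prod>\<^bsub>\<beta>\<in>S, \<alpha>\<notin>S\<^esub> a(x\<^sub>\<beta> - x\<^sub>\<alpha>) / b(x\<^sub>\<beta> - x\<^sub>\<alpha>)\<close>. This sum and \<open>Z(X) \<Prod>\<^sub>k b(x\<^sub>0 - \<mu>\<^sub>k)\<close> are trigonometric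
  polynomials of degree \<open>L\<close> in \<open>\<mu>\<^sub>1\<close>, so it is enough to compare them at \<open>\<mu>\<^sub>1 = x\<^sub>0, x\<^sub>1, \<dots>, x\<^sub>L\<close>. At
  \<open>\<mu>\<^sub>1 = x\<^sub>i\<close>, with \<open>i \<ge> 1\<close>, the commutativity of the B-operators (from the Yang-Baxter equation) moves
  \<open>x\<^sub>i\<close> to the first row, where the lattice freezes, and both sides reduce to size \<open>L - 1\<close>. At
  \<open>\<mu>\<^sub>1 = x\<^sub>0\<close> both sides vanish; for the sum this follows from the formula of size \<open>L - 1\<close> with
  \<open>x\<^sub>0\<close> specialised to \<open>x\<^sub>1\<close> and to \<open>x\<^sub>1 + \<gamma>\<close>. The second formula has the same structure: \<open>det W\<^sub>i\<close> is a
  subset sum over \<open>L - 1\<close> variables, and at \<open>\<mu>\<^sub>1 = x\<^sub>0\<close> it reduces to the first formula. The proof needs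
  \<open>a(x\<^sub>\<alpha> - x\<^sub>\<beta>) \<noteq> 0\<close> for all \<open>\<alpha>, \<beta>\<close>, which continuity in \<open>\<gamma>\<close> removes.
\<close>

subsection \<open>Row transfer matrices\<close>

text \<open>Matrix element of the monodromy matrix. The columns form a list of inhomogeneities, so
  that inductions can peel off the first one; \<open>a\<close> and \<open>a'\<close> are the outer
  auxiliary states.\<close>

fun row_transfer :: "complex \<Rightarrow> complex list \<Rightarrow> complex \<Rightarrow> nat \<Rightarrow> nat list \<Rightarrow> nat \<Rightarrow> nat list \<Rightarrow> complex" where
  "row_transfer \<gamma> [] x a \<sigma> a' \<sigma>' = (if a = a' then 1 else 0)"
| "row_transfer \<gamma> (m # ms) x a \<sigma> a' \<sigma>' =
     (\<Sum>b\<in>{1,2}. Rmat \<gamma> (x - m) (a, hd \<sigma>) (b, hd \<sigma>') * row_transfer \<gamma> ms x b (tl \<sigma>) a' (tl \<sigma>'))"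

text \<open>The numbers of rows and columns are independent, because \<open>Bprod_Cons_1\<close>
  removes a column without removing a row.\<close>

fun Bprod :: "complex \<Rightarrow> complex list \<Rightarrow> complex list \<Rightarrow> nat list \<Rightarrow> nat list \<Rightarrow> complex" where
  "Bprod \<gamma> ms [] \<sigma> \<sigma>' = (if \<sigma> = \<sigma>' then 1 else 0)"
| "Bprod \<gamma> ms (x # xs) \<sigma> \<sigma>' =
     (\<Sum>\<tau>\<in>qbasis (length ms). row_transfer \<gamma> ms x 1 \<sigma> 2 \<tau> * Bprod \<gamma> ms xs \<tau> \<sigma>')"

definition dwpf :: "complex \<Rightarrow> complex list \<Rightarrow> complex list \<Rightarrow> complex" where
  "dwpf \<gamma> ms xs = Bprod \<gamma> ms xs (replicate (length ms) 2) (replicate (length ms) 1)"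

lemma finite_qbasis [simp]: "finite (qbasis n)"
  unfolding qbasis_def using finite_lists_length_eq[of "{1,2::nat}" n] by (simp add: conj_commute)

lemma qbasis_0 [simp]: "qbasis 0 = {[]}"
  by (auto simp: qbasis_def)

lemma Cons_in_qbasis [simp]: "s # \<sigma> \<in> qbasis (Suc n) \<longleftrightarrow> s \<in> {1,2} \<and> \<sigma> \<in> qbasis n"
  by (auto simp: qbasis_def)

lemma qbasis_Suc_E:
  assumes "\<sigma> \<in> qbasis (Suc n)"
  obtains s \<tau> where "\<sigma> = s # \<tau>" "s \<in> {1,2}" "\<tau> \<in> qbasis n"
  using assms by (cases \<sigma>) (auto simp: qbasis_def)

lemma sum_qbasis_Suc:
  fixes f :: "nat list \<Rightarrow> complex"
  shows "(\<Sum>\<tau>\<in>qbasis (Suc n). f \<tau>) = (\<Sum>t\<in>{1,2}. \<Sum>\<tau>\<in>qbasis n. f (t # \<tau>))"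
proof -
  have "bij_betw (\<lambda>(t, \<tau>). t # \<tau>) ({1,2} \<times> qbasis n) (qbasis (Suc n))"
    by (auto simp: bij_betw_def inj_on_def image_def elim!: qbasis_Suc_E)
  from sum.reindex_bij_betw[OF this, of f, symmetric] show ?thesis
    by (simp only: sum.cartesian_product split_def fst_conv snd_conv)
qed

lemma replicate_in_qbasis [simp]: "s \<in> {1,2} \<Longrightarrow> replicate n s \<in> qbasis n"
  by (auto simp: qbasis_def)

text \<open>The product over the factors i > n acts as the identity on the first n quantum sites,
  whence the condition on \<open>take n\<close>; the induction runs downwards from n = L.\<close>

lemma foldr_R0i_eq_row_transfer:
  assumes "n \<le> L" "\<sigma> \<in> qbasis L" "\<sigma>' \<in> qbasis L" "a \<in> {1,2}" "a' \<in> {1,2}"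
  shows "foldr (\<lambda>i M. opmul (fbasis L) (R0i \<gamma> L i (x - \<mu> i)) M) [Suc n..<L+1] opid (a, \<sigma>) (a', \<sigma>')
    = (if take n \<sigma> = take n \<sigma>' then row_transfer \<gamma> (map \<mu> [Suc n..<L+1]) x a (drop n \<sigma>) a' (drop n \<sigma>') else 0)"
  using assms
proof (induction n arbitrary: \<sigma> \<sigma>' a a' rule: inc_induct)
  case base
  then show ?case by (auto simp: opid_def qbasis_def)
next
  case (step n)
  let ?M = "foldr (\<lambda>i M. opmul (fbasis L) (R0i \<gamma> L i (x - \<mu> i)) M) [Suc (Suc n)..<L+1] opid"
  let ?T = "row_transfer \<gamma> (map \<mu> [Suc (Suc n)..<L+1]) x"
  \<comment> \<open>The only intermediate word that contributes: the leading R-matrix changes site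
    \<open>n\<close> alone (counted from 0), and the remaining product preserves sites 0 to
    \<open>n\<close>.\<close>
  let ?\<tau> = "\<sigma>[n := \<sigma>' ! n]"
  let ?g = "\<lambda>b \<tau>. R0i \<gamma> L (Suc n) (x - \<mu> (Suc n)) (a, \<sigma>) (b, \<tau>) * ?M (b, \<tau>) (a', \<sigma>')"
  have len: "length \<sigma> = L" "length \<sigma>' = L" using step.prems by (auto simp: qbasis_def)
  have ins: "set \<sigma> \<subseteq> {1,2}" "set \<sigma>' \<subseteq> {1,2}" using step.prems by (auto simp: qbasis_def)
  have nth: "\<sigma>' ! n \<in> {1,2}" using ins(2) len step.hyps by (metis nth_mem subsetD)
  have \<tau>q: "?\<tau> \<in> qbasis L"
    using len ins nth set_update_subset_insert[of \<sigma> n "\<sigma>' ! n"] by (auto simp: qbasis_def)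
  have other: "?g b \<tau> = 0" if "b \<in> {1,2}" "\<tau> \<in> qbasis L" "\<tau> \<noteq> ?\<tau>" for b \<tau>
  proof (rule ccontr)
    assume nz: "?g b \<tau> \<noteq> 0"
    have lt: "length \<tau> = L" using that by (auto simp: qbasis_def)
    have A: "\<forall>j<L. j \<noteq> n \<longrightarrow> \<sigma> ! j = \<tau> ! j" using nz by (auto simp: R0i_def split: if_splits)
    have "take (Suc n) \<tau> = take (Suc n) \<sigma>'"
      using nz step.IH[OF that(2) step.prems(2) that(1) step.prems(4)] by (auto split: if_splits)
    then have "\<tau> ! n = \<sigma>' ! n" by (metis lessI nth_take)
    then have "\<tau> = ?\<tau>" using A lt len step.hyps
      by (intro nth_equalityI) (simp_all, metis nth_list_update)
    then show False using that by simp
  qed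
  have take_iff: "take (Suc n) ?\<tau> = take (Suc n) \<sigma>' \<longleftrightarrow> take n \<sigma> = take n \<sigma>'"
    using len step.hyps by (simp add: take_Suc_conv_app_nth)
  have "foldr (\<lambda>i M. opmul (fbasis L) (R0i \<gamma> L i (x - \<mu> i)) M) [Suc n..<L+1] opid (a, \<sigma>) (a', \<sigma>')
      = (\<Sum>b\<in>{1,2}. \<Sum>\<tau>\<in>qbasis L. ?g b \<tau>)"
    using step.hyps
    by (simp only: upt_conv_Cons[of "Suc n" "L+1"] foldr.simps o_apply opmul_def fbasis_def sum.cartesian_product)
       (simp add: opmul_def fbasis_def sum.cartesian_product split_def)
  also have "\<dots> = (\<Sum>b\<in>{1,2}. ?g b ?\<tau>)"
  proof (rule sum.cong[OF refl])
    fix b :: nat assume b: "b \<in> {1,2}"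
    have "(\<Sum>\<tau>\<in>qbasis L. ?g b \<tau>) = (\<Sum>\<tau>\<in>{?\<tau>}. ?g b \<tau>)"
      by (rule sum.mono_neutral_right) (use \<tau>q other[OF b] in auto)
    then show "(\<Sum>\<tau>\<in>qbasis L. ?g b \<tau>) = ?g b ?\<tau>" by simp
  qed
  also have "\<dots> = (\<Sum>b\<in>{1,2}. Rmat \<gamma> (x - \<mu> (Suc n)) (a, \<sigma> ! n) (b, \<sigma>' ! n) *
      (if take n \<sigma> = take n \<sigma>' then ?T b (drop (Suc n) \<sigma>) a' (drop (Suc n) \<sigma>') else 0))"
  proof (rule sum.cong[OF refl])
    fix b :: nat assume b: "b \<in> {1,2}"
    show "?g b ?\<tau> = Rmat \<gamma> (x - \<mu> (Suc n)) (a, \<sigma> ! n) (b, \<sigma>' ! n) *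
      (if take n \<sigma> = take n \<sigma>' then ?T b (drop (Suc n) \<sigma>) a' (drop (Suc n) \<sigma>') else 0)"
      unfolding step.IH[OF \<tau>q step.prems(2) b step.prems(4)] take_iff
      using len step.hyps by (simp add: R0i_def)
  qed
  also have "\<dots> = (if take n \<sigma> = take n \<sigma>' then
      row_transfer \<gamma> (map \<mu> [Suc n..<L+1]) x a (drop n \<sigma>) a' (drop n \<sigma>') else 0)"
    using step.hyps len
    by (simp only: upt_conv_Cons[of "Suc n" "L+1"] list.map row_transfer.simps)
       (auto simp: hd_drop_conv_nth tl_drop drop_Suc)
  finally show ?case .
qed

lemma Bop_eq_row_transfer:
  assumes "\<sigma> \<in> qbasis L" "\<sigma>' \<in> qbasis L"
  shows "Bop \<gamma> \<mu> L x \<sigma> \<sigma>' = row_transfer \<gamma> (map \<mu> [1..<L+1]) x 1 \<sigma> 2 \<sigma>'"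
  using foldr_R0i_eq_row_transfer[of 0 L \<sigma> \<sigma>' 1 2] assms
  by (simp add: Bop_def monodromy_def)

lemma Zdw_eq_dwpf: "Zdw \<gamma> \<mu> L x = dwpf \<gamma> (map \<mu> [1..<L+1]) (map x [1..<L+1])"
proof -
  let ?ms = "map \<mu> [1..<L+1]"
  have "foldr (\<lambda>j M. opmul (qbasis L) (Bop \<gamma> \<mu> L (x j)) M) js opid \<sigma> \<sigma>' = Bprod \<gamma> ?ms (map x js) \<sigma> \<sigma>'"
    if "\<sigma> \<in> qbasis L" for js \<sigma> \<sigma>'
    using that
  proof (induction js arbitrary: \<sigma>)
    case Nil
    then show ?case by (simp add: opid_def)
  next
    case (Cons j js)
    then show ?case by (simp add: opmul_def Bop_eq_row_transfer del: upt_Suc)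
  qed
  then show ?thesis by (simp add: Zdw_def dwpf_def del: upt_Suc)
qed

subsection \<open>Yang-Baxter equation and freezing\<close>

lemma weight_identities:
  shows "wa \<gamma> y * wa \<gamma> (x - y) = wa \<gamma> x * sinh \<gamma> + wb y * wb (x - y)"
    and "wb x * wa \<gamma> (x - y) = wa \<gamma> x * wb (x - y) + wb y * sinh \<gamma>"
    and "wb x * wa \<gamma> y = wb y * wa \<gamma> x + sinh \<gamma> * wb (x - y)"
proof -
  have nz: "exp x \<noteq> 0" "exp y \<noteq> 0" "exp \<gamma> \<noteq> 0" by simp_all
  show "wa \<gamma> y * wa \<gamma> (x - y) = wa \<gamma> x * sinh \<gamma> + wb y * wb (x - y)"
    and "wb x * wa \<gamma> (x - y) = wa \<gamma> x * wb (x - y) + wb y * sinh \<gamma>"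
    and "wb x * wa \<gamma> y = wb y * wa \<gamma> x + sinh \<gamma> * wb (x - y)"
    unfolding wa_def wb_def sinh_field_def exp_add exp_diff exp_minus minus_add_distrib minus_diff_eq
    using nz by (simp_all add: field_simps)
qed

lemma yang_baxter:
  assumes "a \<in> {1,2}" "b \<in> {1,2}" "s \<in> {1,2}" "p \<in> {1,2}" "q \<in> {1,2}" "u \<in> {1,2}"
  shows "(\<Sum>c\<in>{1,2}. \<Sum>d\<in>{1,2}. \<Sum>t\<in>{1,2}.
      Rmat \<gamma> (x - y) (a, b) (c, d) * Rmat \<gamma> x (c, s) (p, t) * Rmat \<gamma> y (d, t) (q, u))
    = (\<Sum>c\<in>{1,2}. \<Sum>d\<in>{1,2}. \<Sum>t\<in>{1,2}.
      Rmat \<gamma> y (b, s) (d, t) * Rmat \<gamma> x (a, t) (c, u) * Rmat \<gamma> (x - y) (c, d) (p, q))"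
proof -
  note w = weight_identities[where \<gamma> = \<gamma> and x = x and y = y]
  \<comment> \<open>The components of the equation that survive simplification are the weight
    identities times one further factor c.\<close>
  have w': "sinh \<gamma> * (wa \<gamma> y * wa \<gamma> (x - y)) = sinh \<gamma> * (sinh \<gamma> * wa \<gamma> x) + wb y * (sinh \<gamma> * wb (x - y))"
    "wb x * (sinh \<gamma> * wa \<gamma> (x - y)) = sinh \<gamma> * (wa \<gamma> x * wb (x - y)) + wb y * (sinh \<gamma> * sinh \<gamma>)"
    "wb x * (sinh \<gamma> * wa \<gamma> y) = sinh \<gamma> * (sinh \<gamma> * wb (x - y)) + wb y * (sinh \<gamma> * wa \<gamma> x)"
    using w[THEN arg_cong[where f = "\<lambda>z. sinh \<gamma> * z"]] by (simp_all only: algebra_simps)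
  show ?thesis
    using assms
    apply (elim insertE emptyE)
    apply (simp_all add: Rmat_def wc_def)
    apply (simp_all add: mult_ac)
    apply (simp_all only: w' add.commute)
    done
qed

text \<open>The sum over \<open>\<tau>\<close> is the operator product of two monodromy entries; \<open>(c, d)\<close> are the
  states of the two auxiliary spaces that the R-matrix intertwines.\<close>
lemma RTT_relation:
  assumes "a \<in> {1,2}" "b \<in> {1,2}" "e \<in> {1,2}" "f \<in> {1,2}"
    and "\<sigma> \<in> qbasis (length ms)" "\<sigma>' \<in> qbasis (length ms)"
  shows "(\<Sum>c\<in>{1,2}. \<Sum>d\<in>{1,2}. Rmat \<gamma> (x - y) (a, b) (c, d) *
      (\<Sum>\<tau>\<in>qbasis (length ms). row_transfer \<gamma> ms x c \<sigma> e \<tau> * row_transfer \<gamma> ms y d \<tau> f \<sigma>'))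
    = (\<Sum>c\<in>{1,2}. \<Sum>d\<in>{1,2}.
      (\<Sum>\<tau>\<in>qbasis (length ms). row_transfer \<gamma> ms y b \<sigma> d \<tau> * row_transfer \<gamma> ms x a \<tau> c \<sigma>') *
        Rmat \<gamma> (x - y) (c, d) (e, f))"
  using assms
proof (induction ms arbitrary: a b \<sigma> \<sigma>')
  case Nil
  then show ?case
    by (elim insertE emptyE) (simp_all add: Rmat_def wc_def)
next
  case (Cons m ms)
  obtain s \<rho> where \<sigma>: "\<sigma> = s # \<rho>" "s \<in> {1,2}" "\<rho> \<in> qbasis (length ms)"
    using Cons.prems by (auto elim: qbasis_Suc_E)
  obtain u \<rho>' where \<sigma>': "\<sigma>' = u # \<rho>'" "u \<in> {1,2}" "\<rho>' \<in> qbasis (length ms)"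
    using Cons.prems by (auto elim: qbasis_Suc_E)
  let ?Q = "qbasis (length ms)"
  define T where "T = row_transfer \<gamma> ms"
  define R where "R = Rmat \<gamma> (x - y)"
  define Rx where "Rx = Rmat \<gamma> (x - m)"
  define Ry where "Ry = Rmat \<gamma> (y - m)"
  define P where "P p q = (\<Sum>\<tau>\<in>?Q. T x p \<rho> e \<tau> * T y q \<tau> f \<rho>')" for p q
  define P' where "P' c d e f = (\<Sum>\<tau>\<in>?Q. T y d \<rho> f \<tau> * T x c \<tau> e \<rho>')" for c d e f
  have ybe: "(\<Sum>c\<in>{1,2}. \<Sum>d\<in>{1,2}. \<Sum>t\<in>{1,2}. R (a, b) (c, d) * Rx (c, s) (p, t) * Ry (d, t) (q, u))
    = (\<Sum>c\<in>{1,2}. \<Sum>d\<in>{1,2}. \<Sum>t\<in>{1,2}. Ry (b, s) (d, t) * Rx (a, t) (c, u) * R (c, d) (p, q))"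
    if "p \<in> {1,2}" "q \<in> {1,2}" for p q
    using yang_baxter[OF Cons.prems(1,2) \<sigma>(2) that \<sigma>'(2), of \<gamma> "x - m" "y - m"]
    by (simp add: R_def Rx_def Ry_def)
  have IH: "(\<Sum>p\<in>{1,2}. \<Sum>q\<in>{1,2}. R (c, d) (p, q) * P p q) = (\<Sum>p\<in>{1,2}. \<Sum>q\<in>{1,2}. P' c d p q * R (p, q) (e, f))"
    if "c \<in> {1,2}" "d \<in> {1,2}" for c d
    using Cons.IH[OF that Cons.prems(3,4) \<sigma>(3) \<sigma>'(3)] by (simp only: R_def P_def P'_def T_def)
  have L: "(\<Sum>\<tau>\<in>qbasis (length (m # ms)). row_transfer \<gamma> (m # ms) x c \<sigma> e \<tau> * row_transfer \<gamma> (m # ms) y d \<tau> f \<sigma>')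
     = (\<Sum>t\<in>{1,2}. \<Sum>p\<in>{1,2}. \<Sum>q\<in>{1,2}. Rx (c, s) (p, t) * Ry (d, t) (q, u) * P p q)" for c d
  proof -
    have "(\<Sum>\<tau>\<in>qbasis (length (m # ms)). row_transfer \<gamma> (m # ms) x c \<sigma> e \<tau> * row_transfer \<gamma> (m # ms) y d \<tau> f \<sigma>')
      = (\<Sum>t\<in>{1,2}. \<Sum>\<tau>\<in>?Q. (\<Sum>p\<in>{1,2}. \<Sum>q\<in>{1,2}. Rx (c, s) (p, t) * Ry (d, t) (q, u) * (T x p \<rho> e \<tau> * T y q \<tau> f \<rho>')))"
      unfolding length_Cons sum_qbasis_Suc row_transfer.simps \<sigma>(1) \<sigma>'(1) list.sel T_def[symmetric] Rx_def[symmetric] Ry_def[symmetric]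
      by (simp only: sum_product mult_ac)
    also have "\<dots> = (\<Sum>t\<in>{1,2}. \<Sum>p\<in>{1,2}. \<Sum>q\<in>{1,2}. Rx (c, s) (p, t) * Ry (d, t) (q, u) * P p q)"
      unfolding P_def by (simp only: sum.swap[of _ _ ?Q] sum_distrib_left)
    finally show ?thesis .
  qed
  have L': "(\<Sum>\<tau>\<in>qbasis (length (m # ms)). row_transfer \<gamma> (m # ms) y b \<sigma> d \<tau> * row_transfer \<gamma> (m # ms) x a \<tau> c \<sigma>')
     = (\<Sum>t\<in>{1,2}. \<Sum>q\<in>{1,2}. \<Sum>p\<in>{1,2}. Ry (b, s) (q, t) * Rx (a, t) (p, u) * P' p q c d)" for c d
  proof -
    have "(\<Sum>\<tau>\<in>qbasis (length (m # ms)). row_transfer \<gamma> (m # ms) y b \<sigma> d \<tau> * row_transfer \<gamma> (m # ms) x a \<tau> c \<sigma>')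
      = (\<Sum>t\<in>{1,2}. \<Sum>\<tau>\<in>?Q. (\<Sum>q\<in>{1,2}. \<Sum>p\<in>{1,2}. Ry (b, s) (q, t) * Rx (a, t) (p, u) * (T y q \<rho> d \<tau> * T x p \<tau> c \<rho>')))"
      unfolding length_Cons sum_qbasis_Suc row_transfer.simps \<sigma>(1) \<sigma>'(1) list.sel T_def[symmetric] Rx_def[symmetric] Ry_def[symmetric]
      by (simp only: sum_product) (simp only: mult_ac)
    also have "\<dots> = (\<Sum>t\<in>{1,2}. \<Sum>q\<in>{1,2}. \<Sum>p\<in>{1,2}. Ry (b, s) (q, t) * Rx (a, t) (p, u) * P' p q c d)"
      unfolding P'_def by (simp only: sum.swap[of _ _ ?Q] sum_distrib_left)
    finally show ?thesis .
  qed
  \<comment> \<open>The R-matrix passes through the first column by the Yang-Baxter equation and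
    through the other columns by the induction hypothesis.\<close>
  have "(\<Sum>c\<in>{1,2}. \<Sum>d\<in>{1,2}. R (a, b) (c, d) *
      (\<Sum>t\<in>{1,2}. \<Sum>p\<in>{1,2}. \<Sum>q\<in>{1,2}. Rx (c, s) (p, t) * Ry (d, t) (q, u) * P p q))
    = (\<Sum>p\<in>{1,2}. \<Sum>q\<in>{1,2}. (\<Sum>c\<in>{1,2}. \<Sum>d\<in>{1,2}. \<Sum>t\<in>{1,2}.
         R (a, b) (c, d) * Rx (c, s) (p, t) * Ry (d, t) (q, u)) * P p q)"
    by (simp add: algebra_simps)
  also have "\<dots> = (\<Sum>p\<in>{1,2}. \<Sum>q\<in>{1,2}. (\<Sum>c\<in>{1,2}. \<Sum>d\<in>{1,2}. \<Sum>t\<in>{1,2}.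
         Ry (b, s) (d, t) * Rx (a, t) (c, u) * R (c, d) (p, q)) * P p q)"
    by (intro sum.cong refl) (simp only: ybe)
  also have "\<dots> = (\<Sum>c\<in>{1,2}. \<Sum>d\<in>{1,2}. \<Sum>t\<in>{1,2}. Ry (b, s) (d, t) * Rx (a, t) (c, u) *
         (\<Sum>p\<in>{1,2}. \<Sum>q\<in>{1,2}. R (c, d) (p, q) * P p q))"
    by (simp add: algebra_simps)
  also have "\<dots> = (\<Sum>c\<in>{1,2}. \<Sum>d\<in>{1,2}. \<Sum>t\<in>{1,2}. Ry (b, s) (d, t) * Rx (a, t) (c, u) *
         (\<Sum>p\<in>{1,2}. \<Sum>q\<in>{1,2}. P' c d p q * R (p, q) (e, f)))"
    by (intro sum.cong refl) (simp only: IH)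
  also have "\<dots> = (\<Sum>c\<in>{1,2}. \<Sum>d\<in>{1,2}.
      (\<Sum>t\<in>{1,2}. \<Sum>q\<in>{1,2}. \<Sum>p\<in>{1,2}. Ry (b, s) (q, t) * Rx (a, t) (p, u) * P' p q c d) * R (c, d) (e, f))"
    by (simp add: algebra_simps)
  finally show ?case unfolding L L' R_def .
qed

text \<open>In the component (1,1), (2,2) of the RTT relation both R-matrices reduce to the single
  entry a(x - y), which cancels because it is nonzero.\<close>

lemma B_commute:
  assumes "wa \<gamma> (x - y) \<noteq> 0" "\<sigma> \<in> qbasis (length ms)" "\<sigma>' \<in> qbasis (length ms)"
  shows "(\<Sum>\<tau>\<in>qbasis (length ms). row_transfer \<gamma> ms x 1 \<sigma> 2 \<tau> * row_transfer \<gamma> ms y 1 \<tau> 2 \<sigma>')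
    = (\<Sum>\<tau>\<in>qbasis (length ms). row_transfer \<gamma> ms y 1 \<sigma> 2 \<tau> * row_transfer \<gamma> ms x 1 \<tau> 2 \<sigma>')"
  using RTT_relation[of 1 1 2 2 \<sigma> ms \<sigma>' \<gamma> x y] assms by (simp add: Rmat_def)

lemma Bprod_swap:
  assumes "wa \<gamma> (x - y) \<noteq> 0" "\<sigma> \<in> qbasis (length ms)"
  shows "Bprod \<gamma> ms (x # y # xs) \<sigma> \<sigma>' = Bprod \<gamma> ms (y # x # xs) \<sigma> \<sigma>'"
proof -
  let ?Q = "qbasis (length ms)"
  have eq: "Bprod \<gamma> ms (x # y # xs) \<sigma> \<sigma>' = (\<Sum>\<rho>\<in>?Q.
    (\<Sum>\<tau>\<in>?Q. row_transfer \<gamma> ms x 1 \<sigma> 2 \<tau> * row_transfer \<gamma> ms y 1 \<tau> 2 \<rho>) * Bprod \<gamma> ms xs \<rho> \<sigma>')" for x y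
    unfolding Bprod.simps sum_distrib_left sum_distrib_right mult.assoc by (rule sum.swap)
  show ?thesis unfolding eq by (intro sum.cong refl) (simp only: B_commute[OF assms])
qed

lemma Bprod_move_to_front:
  assumes "\<forall>u\<in>set us. wa \<gamma> (u - x) \<noteq> 0" "\<sigma> \<in> qbasis (length ms)"
  shows "Bprod \<gamma> ms (us @ x # xs) \<sigma> \<sigma>' = Bprod \<gamma> ms (x # us @ xs) \<sigma> \<sigma>'"
  using assms
proof (induction us arbitrary: \<sigma>)
  case (Cons u us)
  have "Bprod \<gamma> ms ((u # us) @ x # xs) \<sigma> \<sigma>' = Bprod \<gamma> ms (u # x # us @ xs) \<sigma> \<sigma>'"
    using Cons by simp
  also have "\<dots> = Bprod \<gamma> ms (x # (u # us) @ xs) \<sigma> \<sigma>'"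
    unfolding append_Cons using Cons.prems by (intro Bprod_swap) auto
  finally show ?case .
qed simp

lemma dwpf_move_to_front:
  assumes "\<forall>u\<in>set us. wa \<gamma> (u - x) \<noteq> 0"
  shows "dwpf \<gamma> ms (us @ x # xs) = dwpf \<gamma> ms (x # us @ xs)"
  unfolding dwpf_def using assms by (intro Bprod_move_to_front) auto

text \<open>In the column of the head inhomogeneity \<open>m\<close>, the state changes from 2 to 1 at the unique
  c-vertex; above it all vertices are of type b, below it of type a.\<close>

lemma Bprod_Cons_1:
  "Bprod \<gamma> (m # ms) xs (1 # \<sigma>) (1 # \<sigma>') = (\<Prod>x\<leftarrow>xs. wa \<gamma> (x - m)) * Bprod \<gamma> ms xs \<sigma> \<sigma>'"
proof (induction xs arbitrary: \<sigma>)
  case (Cons x xs)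
  show ?case
    unfolding Bprod.simps length_Cons sum_qbasis_Suc
    by (simp add: Cons[simplified] Rmat_def sum_distrib_left mult_ac)
qed simp

text \<open>The c-vertex lies either below the first row or in it. This recursion yields both the
  freezing at m = x and the degree in \<open>m\<close>.\<close>

lemma Bprod_Cons_2:
  "Bprod \<gamma> (m # ms) (x # xs) (2 # \<sigma>) (1 # \<sigma>') =
     wb (x - m) * (\<Sum>\<tau>\<in>qbasis (length ms). row_transfer \<gamma> ms x 1 \<sigma> 2 \<tau> * Bprod \<gamma> (m # ms) xs (2 # \<tau>) (1 # \<sigma>'))
   + sinh \<gamma> * (\<Prod>x\<leftarrow>xs. wa \<gamma> (x - m)) *
       (\<Sum>\<tau>\<in>qbasis (length ms). row_transfer \<gamma> ms x 2 \<sigma> 2 \<tau> * Bprod \<gamma> ms xs \<tau> \<sigma>')"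
  unfolding Bprod.simps length_Cons sum_qbasis_Suc
  by (simp add: Bprod_Cons_1[simplified] Rmat_def wc_def sum_distrib_left mult_ac)

lemma row_transfer_all_2:
  assumes "\<tau> \<in> qbasis (length ms)"
  shows "row_transfer \<gamma> ms x 2 (replicate (length ms) 2) 2 \<tau> =
    (if \<tau> = replicate (length ms) 2 then \<Prod>m\<leftarrow>ms. wa \<gamma> (x - m) else 0)"
  using assms
proof (induction ms arbitrary: \<tau>)
  case (Cons m ms)
  then obtain t \<rho> where "\<tau> = t # \<rho>" "t \<in> {1,2}" "\<rho> \<in> qbasis (length ms)"
    by (auto elim: qbasis_Suc_E)
  with Cons.IH[of \<rho>] show ?case by (auto simp: Rmat_def)
qed simp

text \<open>Korepin's recursion: b(x - m) vanishes at m = x, which forces the c-vertex into the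
  corner, and the rest of the first row and first column then consists of a-vertices.\<close>

lemma dwpf_freeze:
  "dwpf \<gamma> (x # ms) (x # xs) =
     sinh \<gamma> * (\<Prod>m\<leftarrow>ms. wa \<gamma> (x - m)) * (\<Prod>y\<leftarrow>xs. wa \<gamma> (y - x)) * dwpf \<gamma> ms xs"
proof -
  let ?r = "replicate (length ms) (2::nat)"
  have "dwpf \<gamma> (x # ms) (x # xs) = sinh \<gamma> * (\<Prod>y\<leftarrow>xs. wa \<gamma> (y - x)) *
      (\<Sum>\<tau>\<in>qbasis (length ms). row_transfer \<gamma> ms x 2 ?r 2 \<tau> * Bprod \<gamma> ms xs \<tau> (replicate (length ms) 1))"
    unfolding dwpf_def length_Cons replicate_Suc Bprod_Cons_2 by (simp add: wb_def)
  also have "(\<Sum>\<tau>\<in>qbasis (length ms). row_transfer \<gamma> ms x 2 ?r 2 \<tau> * Bprod \<gamma> ms xs \<tau> (replicate (length ms) 1))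
     = (\<Sum>\<tau>\<in>{?r}. row_transfer \<gamma> ms x 2 ?r 2 \<tau> * Bprod \<gamma> ms xs \<tau> (replicate (length ms) 1))"
    by (rule sum.mono_neutral_right) (auto simp: row_transfer_all_2)
  finally show ?thesis by (simp add: row_transfer_all_2 dwpf_def)
qed

lemma dwpf_Nil [simp]: "dwpf \<gamma> [] [] = 1"
  by (simp add: dwpf_def)

subsection \<open>Trigonometric interpolation\<close>

text \<open>Equivalently, \<open>f\<close> lies in the span of \<open>u \<mapsto> exp ((n - 2 j) u)\<close> for \<open>0 \<le> j \<le> n\<close>.\<close>
definition trig_poly :: "nat \<Rightarrow> (complex \<Rightarrow> complex) \<Rightarrow> bool" where
  "trig_poly n f \<longleftrightarrow> (\<exists>p. degree p \<le> n \<and> (\<forall>u. f u * exp u ^ n = poly p (exp (2 * u))))"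

lemma trig_polyI: "degree p \<le> n \<Longrightarrow> (\<And>u. f u * exp u ^ n = poly p (exp (2 * u))) \<Longrightarrow> trig_poly n f"
  unfolding trig_poly_def by blast

lemma trig_poly_const: "trig_poly 0 (\<lambda>_. c)"
  by (rule trig_polyI[of "[:c:]"]) simp_all

lemma trig_poly_zero: "trig_poly n (\<lambda>_. 0)"
  by (rule trig_polyI[of 0]) simp_all

lemma trig_poly_sinh: "trig_poly 1 (\<lambda>u. sinh (c - u))"
proof (rule trig_polyI[of "[:exp c / 2, - exp (- c) / 2:]"])
  fix u :: complex
  have "exp (2 * u) = exp u * exp u" by (simp only: mult_2 exp_add)
  moreover have "sinh (c - u) = (exp c / exp u - exp u / exp c) / 2"
    by (simp only: sinh_field_def minus_diff_eq exp_diff)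
  moreover have "(a / v - v / a) / 2 * v ^ 1 = poly [:a / 2, - inverse a / 2:] (v * v)"
    if "v \<noteq> 0" for a v :: complex
    using that by (simp add: field_simps)
  ultimately show "sinh (c - u) * exp u ^ 1 = poly [:exp c / 2, - exp (- c) / 2:] (exp (2 * u))"
    by (simp only: exp_minus exp_not_eq_zero not_False_eq_True)
qed simp

lemma trig_poly_add:
  assumes "trig_poly n f" "trig_poly n g"
  shows "trig_poly n (\<lambda>u. f u + g u)"
proof -
  obtain p q where "degree p \<le> n" "degree q \<le> n"
    "\<And>u. f u * exp u ^ n = poly p (exp (2 * u))" "\<And>u. g u * exp u ^ n = poly q (exp (2 * u))"
    using assms unfolding trig_poly_def by blast
  then show ?thesis
    by (intro trig_polyI[of "p + q"]) (simp_all add: degree_add_le algebra_simps)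
qed

lemma trig_poly_mult:
  assumes "trig_poly n f" "trig_poly m g"
  shows "trig_poly (n + m) (\<lambda>u. f u * g u)"
proof -
  obtain p q where pq: "degree p \<le> n" "degree q \<le> m"
    "\<And>u. f u * exp u ^ n = poly p (exp (2 * u))" "\<And>u. g u * exp u ^ m = poly q (exp (2 * u))"
    using assms unfolding trig_poly_def by blast
  show ?thesis
  proof (rule trig_polyI[of "p * q"])
    show "degree (p * q) \<le> n + m" using degree_mult_le[of p q] pq by linarith
    show "f u * g u * exp u ^ (n + m) = poly (p * q) (exp (2 * u))" for u
      by (simp add: pq(3,4)[symmetric] power_add)
  qed
qed

lemma trig_poly_cmult: "trig_poly n f \<Longrightarrow> trig_poly n (\<lambda>u. c * f u)"
  using trig_poly_mult[OF trig_poly_const[of c]] by simp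

lemma trig_poly_multc: "trig_poly n f \<Longrightarrow> trig_poly n (\<lambda>u. f u * c)"
  using trig_poly_mult[OF _ trig_poly_const[of c]] by simp

lemma trig_poly_diff:
  assumes "trig_poly n f" "trig_poly n g"
  shows "trig_poly n (\<lambda>u. f u - g u)"
  using trig_poly_add[OF assms(1) trig_poly_cmult[OF assms(2), of "-1"]] by simp

lemma trig_poly_sum:
  "(\<And>i. i \<in> I \<Longrightarrow> trig_poly n (f i)) \<Longrightarrow> trig_poly n (\<lambda>u. \<Sum>i\<in>I. f i u)"
  by (induction I rule: infinite_finite_induct) (auto intro: trig_poly_add trig_poly_zero)

lemma trig_poly_prod:
  assumes "finite I" "\<And>i. i \<in> I \<Longrightarrow> trig_poly 1 (f i)"
  shows "trig_poly (card I) (\<lambda>u. \<Prod>i\<in>I. f i u)"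
  using assms
proof (induction I)
  case empty
  then show ?case using trig_poly_const[of 1] by simp
next
  case (insert i I)
  then show ?case using trig_poly_mult[of 1 "f i" "card I"] by simp
qed

lemma trig_poly_prod_list:
  assumes "\<And>y. y \<in> set ys \<Longrightarrow> trig_poly 1 (f y)"
  shows "trig_poly (length ys) (\<lambda>u. \<Prod>y\<leftarrow>ys. f y u)"
  using assms
proof (induction ys)
  case Nil
  then show ?case using trig_poly_const[of 1] by simp
next
  case (Cons y ys)
  then show ?case using trig_poly_mult[of 1 "f y" "length ys"] by simp
qed

lemma exp_2_eqD:
  fixes z w :: complex
  assumes "exp (2 * z) = exp (2 * w)"
  shows "sinh (z - w) = 0"
proof -
  have "exp z * exp z = exp w * exp w"
    using assms by (simp add: exp_double power2_eq_square)
  then show ?thesis by (simp add: sinh_field_def exp_diff exp_minus field_simps)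
qed

text \<open>In the variable exp(2u) this is the root bound for polynomials; by
  \<open>exp_2_eqD\<close>, nodes whose differences are not zeros of sinh stay distinct in that
  variable.\<close>

lemma trig_poly_eq_0:
  assumes "trig_poly n f" "finite Z" "n < card Z" "\<And>z. z \<in> Z \<Longrightarrow> f z = 0"
    and "\<And>z w. z \<in> Z \<Longrightarrow> w \<in> Z \<Longrightarrow> z \<noteq> w \<Longrightarrow> sinh (z - w) \<noteq> 0"
  shows "f u = 0"
proof -
  obtain p where p: "degree p \<le> n" "\<And>u. f u * exp u ^ n = poly p (exp (2 * u))"
    using assms(1) unfolding trig_poly_def by blast
  have "p = 0"
  proof (rule ccontr)
    assume "p \<noteq> 0"
    have inj: "inj_on (\<lambda>z. exp (2 * z)) Z"
      by (rule inj_onI) (use assms(5) exp_2_eqD in blast)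
    have sub: "(\<lambda>z. exp (2 * z)) ` Z \<subseteq> {x. poly p x = 0}"
      using p(2) assms(4) by (metis (mono_tags, lifting) image_subsetI mem_Collect_eq mult_zero_left)
    have "card Z \<le> card {x. poly p x = 0}"
      using card_mono[OF poly_roots_finite[OF \<open>p \<noteq> 0\<close>] sub] card_image[OF inj] by simp
    also have "\<dots> \<le> degree p" by (rule card_poly_roots_bound[OF \<open>p \<noteq> 0\<close>])
    finally show False using p(1) assms(3) by linarith
  qed
  then show ?thesis using p(2)[of u] by simp
qed

lemma trig_poly_wa: "trig_poly 1 (\<lambda>u. wa \<gamma> (x - u))"
  using trig_poly_sinh[of "x + \<gamma>"] by (simp add: wa_def algebra_simps)

lemma trig_poly_wb: "trig_poly 1 (\<lambda>u. wb (x - u))"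
  using trig_poly_sinh[of x] by (simp add: wb_def)

text \<open>The degree is one less than the number of rows, because the c-vertex in the column of
  \<open>m\<close> has a weight independent of \<open>m\<close>.\<close>

lemma trig_poly_Bprod:
  "trig_poly (length xs) (\<lambda>m. Bprod \<gamma> (m # ms) (x # xs) (2 # \<sigma>) (1 # \<sigma>'))"
proof (induction xs arbitrary: x \<sigma>)
  case Nil
  have "(\<lambda>m. Bprod \<gamma> (m # ms) [x] (2 # \<sigma>) (1 # \<sigma>')) = (\<lambda>m. sinh \<gamma> *
      (\<Sum>\<tau>\<in>qbasis (length ms). row_transfer \<gamma> ms x 2 \<sigma> 2 \<tau> * Bprod \<gamma> ms [] \<tau> \<sigma>'))"
    unfolding Bprod_Cons_2 by simp
  then show ?case using trig_poly_const by simp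
next
  case (Cons y xs)
  have 1: "trig_poly (1 + length xs) (\<lambda>m. wb (x - m) * (\<Sum>\<tau>\<in>qbasis (length ms).
      row_transfer \<gamma> ms x 1 \<sigma> 2 \<tau> * Bprod \<gamma> (m # ms) (y # xs) (2 # \<tau>) (1 # \<sigma>')))"
    by (intro trig_poly_mult trig_poly_wb trig_poly_sum trig_poly_cmult Cons.IH)
  have 2: "trig_poly (length (y # xs)) (\<lambda>m. sinh \<gamma> * (\<Prod>x\<leftarrow>y # xs. wa \<gamma> (x - m)) *
       (\<Sum>\<tau>\<in>qbasis (length ms). row_transfer \<gamma> ms x 2 \<sigma> 2 \<tau> * Bprod \<gamma> ms (y # xs) \<tau> \<sigma>'))"
    by (intro trig_poly_multc trig_poly_cmult trig_poly_prod_list trig_poly_wa)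
  show ?case
    using trig_poly_add[OF 1 2[unfolded length_Cons Suc_eq_plus1_left]]
    unfolding Bprod_Cons_2 length_Cons Suc_eq_plus1_left .
qed

lemma trig_poly_dwpf: "trig_poly (length xs) (\<lambda>m. dwpf \<gamma> (m # ms) (x # xs))"
  unfolding dwpf_def length_Cons replicate_Suc by (rule trig_poly_Bprod)

section \<open>Removing exceptional points by continuity\<close>

lemma eventually_sinh_nonzero: "eventually (\<lambda>w. sinh (w - d) \<noteq> 0) (at (z::complex))"
proof (cases "sinh (z - d) = 0")
  case False
  have "((\<lambda>w. sinh (w - d)) \<longlongrightarrow> sinh (z - d)) (at z)"
    by (intro tendsto_intros)
  then show ?thesis using False by (rule tendsto_imp_eventually_ne)
next
  case True
  have "((\<lambda>w. sinh (w - d)) has_field_derivative cosh (z - d)) (at z)"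
    by (auto intro!: derivative_eq_intros)
  then have "((\<lambda>w. sinh (w - d) / (w - z)) \<longlongrightarrow> cosh (z - d)) (at z)"
    using True by (simp add: has_field_derivative_iff)
  \<comment> \<open>All zeros of sinh are simple, hence isolated.\<close>
  moreover have "cosh (z - d) \<noteq> 0"
    using True hyperbolic_pythagoras[of "z - d"] by auto
  ultimately have "eventually (\<lambda>w. sinh (w - d) / (w - z) \<noteq> 0) (at z)"
    by (rule tendsto_imp_eventually_ne)
  then show ?thesis by eventually_elim auto
qed

text \<open>The exceptional points are isolated, so f vanishes on a punctured neighbourhood of z.
  Applied below to the free point \<open>y\<close> and to \<gamma>.\<close>

lemma continuous_eq_0_of_generic:
  fixes f :: "complex \<Rightarrow> complex"
  assumes "continuous_on UNIV f" "finite D" "\<And>w. \<forall>d\<in>D. sinh (w - d) \<noteq> 0 \<Longrightarrow> f w = 0"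
  shows "f z = 0"
proof -
  have "eventually (\<lambda>w. \<forall>d\<in>D. sinh (w - d) \<noteq> 0) (at z)"
    using assms(2) by (intro eventually_ball_finite ballI eventually_sinh_nonzero)
  then have "eventually (\<lambda>w. f w = 0) (at z)"
    by eventually_elim (rule assms(3))
  then have "(f \<longlongrightarrow> 0) (at z)" by (rule tendsto_eventually)
  moreover have "(f \<longlongrightarrow> f z) (at z)"
    using assms(1) by (simp add: continuous_on_def)
  ultimately show ?thesis using tendsto_unique[OF at_neq_bot] by metis
qed

subsection \<open>Subset sums\<close>

definition ratio :: "complex \<Rightarrow> complex \<Rightarrow> complex" where
  "ratio \<gamma> u = wa \<gamma> u / wb u"

text \<open>The weights \<open>f\<close> and \<open>g\<close> are arbitrary functions, so that
  removing, freezing or rescaling an index only changes the weights.\<close>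

definition subset_sum ::
  "complex \<Rightarrow> (nat \<Rightarrow> complex) \<Rightarrow> nat set \<Rightarrow> (nat \<Rightarrow> complex) \<Rightarrow> (nat \<Rightarrow> complex) \<Rightarrow> complex" where
  "subset_sum \<gamma> x I f g = (\<Sum>S\<in>Pow I. (\<Prod>\<alpha>\<in>I - S. f \<alpha>) *
     (\<Prod>\<beta>\<in>S. - g \<beta> * (\<Prod>k\<in>I - S. ratio \<gamma> (x \<beta> - x k))))"

lemma subset_sum_empty [simp]: "subset_sum \<gamma> x {} f g = 1"
  by (simp add: subset_sum_def)

lemma subset_sum_cong:
  assumes "\<And>i. i \<in> I \<Longrightarrow> f i = f' i" "\<And>i. i \<in> I \<Longrightarrow> g i = g' i"
  shows "subset_sum \<gamma> x I f g = subset_sum \<gamma> x I f' g'"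
  unfolding subset_sum_def
  by (intro sum.cong refl arg_cong2[where f = "(*)"] prod.cong arg_cong[where f = uminus]) (use assms in auto)

text \<open>Split by whether i lies in S. If not, its ratio with each \<beta> in S is absorbed into
  \<open>g\<close>; if so, its ratios with the indices outside S are absorbed into
  \<open>f\<close>.\<close>

lemma subset_sum_insert:
  assumes "finite I" "i \<notin> I"
  shows "subset_sum \<gamma> x (insert i I) f g =
      f i * subset_sum \<gamma> x I f (\<lambda>\<beta>. g \<beta> * ratio \<gamma> (x \<beta> - x i))
    - g i * subset_sum \<gamma> x I (\<lambda>\<alpha>. f \<alpha> * ratio \<gamma> (x i - x \<alpha>)) g"
proof -
  let ?t = "\<lambda>J S. (\<Prod>\<alpha>\<in>J - S. f \<alpha>) * (\<Prod>\<beta>\<in>S. - g \<beta> * (\<Prod>k\<in>J - S. ratio \<gamma> (x \<beta> - x k)))"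
  have inj: "inj_on (insert i) (Pow I)"
    using assms(2) by (auto simp: inj_on_def)
  have "subset_sum \<gamma> x (insert i I) f g = (\<Sum>S\<in>Pow I. ?t (insert i I) S) + (\<Sum>S\<in>Pow I. ?t (insert i I) (insert i S))"
    unfolding subset_sum_def Pow_insert
    by (subst sum.union_disjoint) (use assms in \<open>auto simp: sum.reindex[OF inj] simp del: insert_Diff_single\<close>)
  also have "(\<Sum>S\<in>Pow I. ?t (insert i I) S) = f i * subset_sum \<gamma> x I f (\<lambda>\<beta>. g \<beta> * ratio \<gamma> (x \<beta> - x i))"
    unfolding subset_sum_def sum_distrib_left
  proof (rule sum.cong[OF refl])
    fix S assume S: "S \<in> Pow I"
    then have d: "insert i I - S = insert i (I - S)" and ni: "i \<notin> I - S" "finite (I - S)"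
      using assms by auto
    show "?t (insert i I) S = f i * ((\<Prod>\<alpha>\<in>I - S. f \<alpha>) *
       (\<Prod>\<beta>\<in>S. - (g \<beta> * ratio \<gamma> (x \<beta> - x i)) * (\<Prod>k\<in>I - S. ratio \<gamma> (x \<beta> - x k))))"
      unfolding d using ni by (simp add: mult_ac)
  qed
  also have "(\<Sum>S\<in>Pow I. ?t (insert i I) (insert i S))
      = - (g i * subset_sum \<gamma> x I (\<lambda>\<alpha>. f \<alpha> * ratio \<gamma> (x i - x \<alpha>)) g)"
    unfolding subset_sum_def sum_distrib_left sum_negf[symmetric]
  proof (rule sum.cong[OF refl])
    fix S assume S: "S \<in> Pow I"
    then have d: "insert i I - insert i S = I - S" and ni: "i \<notin> S" "finite S"
      using assms by (auto intro: finite_subset)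
    show "?t (insert i I) (insert i S) = - (g i * ((\<Prod>\<alpha>\<in>I - S. f \<alpha> * ratio \<gamma> (x i - x \<alpha>)) *
       (\<Prod>\<beta>\<in>S. - g \<beta> * (\<Prod>k\<in>I - S. ratio \<gamma> (x \<beta> - x k)))))"
      unfolding d using ni by (simp add: prod.distrib mult_ac)
  qed
  finally show ?thesis by simp
qed

text \<open>Every index contributes exactly one of its two weights, so a factor common to both
  leaves the sum.\<close>

lemma subset_sum_scale:
  assumes "finite I"
  shows "subset_sum \<gamma> x I (\<lambda>\<alpha>. h \<alpha> * f \<alpha>) (\<lambda>\<beta>. h \<beta> * g \<beta>) = (\<Prod>i\<in>I. h i) * subset_sum \<gamma> x I f g"
  unfolding subset_sum_def sum_distrib_left
proof (rule sum.cong[OF refl])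
  fix S assume S: "S \<in> Pow I"
  have "(\<Prod>i\<in>I. h i) = (\<Prod>i\<in>I - S. h i) * (\<Prod>i\<in>S. h i)"
    using S assms by (intro prod.subset_diff) auto
  moreover have "(\<Prod>\<beta>\<in>S. - (h \<beta> * g \<beta>) * (\<Prod>k\<in>I - S. ratio \<gamma> (x \<beta> - x k)))
      = (\<Prod>i\<in>S. h i) * (\<Prod>\<beta>\<in>S. - g \<beta> * (\<Prod>k\<in>I - S. ratio \<gamma> (x \<beta> - x k)))"
    unfolding prod.distrib[symmetric] by (intro prod.cong refl) simp
  ultimately show "(\<Prod>\<alpha>\<in>I - S. h \<alpha> * f \<alpha>) * (\<Prod>\<beta>\<in>S. - (h \<beta> * g \<beta>) * (\<Prod>k\<in>I - S. ratio \<gamma> (x \<beta> - x k)))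
    = (\<Prod>i\<in>I. h i) * ((\<Prod>\<alpha>\<in>I - S. f \<alpha>) * (\<Prod>\<beta>\<in>S. - g \<beta> * (\<Prod>k\<in>I - S. ratio \<gamma> (x \<beta> - x k))))"
    by (simp only: prod.distrib mult_ac)
qed

lemma subset_sum_scale_eq:
  assumes "finite I" "\<And>i. i \<in> I \<Longrightarrow> f' i = h i * f i" "\<And>i. i \<in> I \<Longrightarrow> g' i = h i * g i"
  shows "subset_sum \<gamma> x I f' g' = (\<Prod>i\<in>I. h i) * subset_sum \<gamma> x I f g"
  unfolding subset_sum_scale[OF assms(1), symmetric] by (rule subset_sum_cong) (use assms in auto)

lemma trig_poly_subset_sum:
  assumes "finite I" "\<And>i. i \<in> I \<Longrightarrow> trig_poly 1 (\<lambda>m. f m i)" "\<And>i. i \<in> I \<Longrightarrow> trig_poly 1 (\<lambda>m. g m i)"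
  shows "trig_poly (card I) (\<lambda>m. subset_sum \<gamma> x I (f m) (g m))"
  unfolding subset_sum_def
proof (rule trig_poly_sum)
  fix S assume "S \<in> Pow I"
  then have S: "S \<subseteq> I" "finite S" using assms(1) by (auto intro: finite_subset)
  have c: "card (I - S) + card S = card I"
    using S assms(1) by (metis card_Diff_subset card_mono le_add_diff_inverse2)
  have "trig_poly (card (I - S) + card S) (\<lambda>m. (\<Prod>\<alpha>\<in>I - S. f m \<alpha>) *
      (\<Prod>\<beta>\<in>S. - (\<Prod>k\<in>I - S. ratio \<gamma> (x \<beta> - x k)) * g m \<beta>))"
    using S assms by (intro trig_poly_mult trig_poly_prod trig_poly_cmult) auto
  then show "trig_poly (card I) (\<lambda>m. (\<Prod>\<alpha>\<in>I - S. f m \<alpha>) *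
      (\<Prod>\<beta>\<in>S. - g m \<beta> * (\<Prod>k\<in>I - S. ratio \<gamma> (x \<beta> - x k))))"
    unfolding c by (simp add: mult_ac)
qed

text \<open>Counterpart of \<open>dwpf_freeze\<close>: since g' vanishes at i, only subsets without
  i remain, and their ratios with i turn the b in g' into a. Then a(x_j - x_i) is common to both
  weights.\<close>

lemma subset_sum_freeze:
  assumes "finite I" "i \<notin> I" "\<And>j. j \<in> I \<Longrightarrow> wb (x j - x i) \<noteq> 0"
    and "\<And>j. j \<in> insert i I \<Longrightarrow> f' j = wa \<gamma> (x j - x i) * f j"
    and "\<And>j. j \<in> insert i I \<Longrightarrow> g' j = wb (x j - x i) * g j"
  shows "subset_sum \<gamma> x (insert i I) f' g' = sinh \<gamma> * f i * (\<Prod>j\<in>I. wa \<gamma> (x j - x i)) * subset_sum \<gamma> x I f g"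
proof -
  have g0: "g' i = 0" and fi: "f' i = sinh \<gamma> * f i"
    using assms(4,5)[of i] by (simp_all add: wa_def wb_def)
  have "subset_sum \<gamma> x I f' (\<lambda>\<beta>. g' \<beta> * ratio \<gamma> (x \<beta> - x i)) = (\<Prod>j\<in>I. wa \<gamma> (x j - x i)) * subset_sum \<gamma> x I f g"
    using assms by (intro subset_sum_scale_eq) (auto simp: ratio_def)
  then show ?thesis unfolding subset_sum_insert[OF assms(1,2)] g0 fi by simp
qed

text \<open>\<open>A_eig\<close> and \<open>D_eig\<close> are the eigenvalues of A(z) and D(z) on
  the reference state.\<close>

abbreviation A_eig :: "complex \<Rightarrow> complex list \<Rightarrow> complex \<Rightarrow> complex" where
  "A_eig \<gamma> ms z \<equiv> \<Prod>m\<leftarrow>ms. wa \<gamma> (z - m)"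

abbreviation D_eig :: "complex list \<Rightarrow> complex \<Rightarrow> complex" where
  "D_eig ms z \<equiv> \<Prod>m\<leftarrow>ms. wb (z - m)"

lemma continuous_on_D_eig: "continuous_on UNIV (D_eig ms)"
  by (induction ms) (auto intro!: continuous_intros simp: wb_def)

lemma wb_minus: "wb (- u) = - wb u"
  by (simp add: wb_def)

lemma wb_commute: "wb (u - v) = - wb (v - u)"
  using wb_minus[of "v - u"] by simp

lemma wb_sub_gamma: "wb (u - v - \<gamma>) = - wa \<gamma> (v - u)"
  using wb_minus[of "v - u + \<gamma>"] by (simp add: wb_def wa_def algebra_simps)

lemma wb_add_gamma: "wb (u + \<gamma> - v) = wa \<gamma> (u - v)"
  by (simp add: wb_def wa_def algebra_simps)

section \<open>Evaluating subset sums by partition functions\<close>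

locale generic_points =
  fixes \<gamma> :: complex and x :: "nat \<Rightarrow> complex" and I :: "nat set"
  assumes wb_nz: "i \<in> I \<Longrightarrow> j \<in> I \<Longrightarrow> i \<noteq> j \<Longrightarrow> wb (x i - x j) \<noteq> 0"
    and wa_nz: "i \<in> I \<Longrightarrow> j \<in> I \<Longrightarrow> i \<noteq> j \<Longrightarrow> wa \<gamma> (x i - x j) \<noteq> 0"
begin

lemma inj_x: "inj_on x I"
  using wb_nz by (fastforce simp: inj_on_def wb_def)

text \<open>Commutativity of the B-operators brings x_i to the first row, where the lattice
  freezes.\<close>

lemma dwpf_freeze_at:
  assumes "set (us @ i # vs) \<subseteq> I" "distinct (us @ i # vs)"
  shows "dwpf \<gamma> (x i # ms) (map x (us @ i # vs)) =
    sinh \<gamma> * A_eig \<gamma> ms (x i) * (\<Prod>j\<in>set (us @ vs). wa \<gamma> (x j - x i)) * dwpf \<gamma> ms (map x (us @ vs))"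
proof -
  have "dwpf \<gamma> (x i # ms) (map x (us @ i # vs)) = dwpf \<gamma> (x i # ms) (x i # map x (us @ vs))"
    using dwpf_move_to_front[of "map x us" \<gamma> "x i" "x i # ms" "map x vs"] assms wa_nz by auto
  moreover have "distinct (us @ vs)" using assms(2) by simp
  ultimately show ?thesis by (simp only: dwpf_freeze prod.distinct_set_conv_list map_map o_def)
qed

text \<open>Splitting off i gives two sums over \<open>J\<close>. Multiplied by the product of the
  b(x_i - x_j), they are the sums in \<open>F\<close> at y = x_i and at y = x_i + \<gamma>, so the
  total is A(x_i) D(x_i) Z - D(x_i) A(x_i) Z.\<close>

lemma subset_sum_zero:
  assumes "finite J" "insert i J \<subseteq> I" "i \<notin> J"
    and F: "\<And>y. subset_sum \<gamma> x J (\<lambda>\<alpha>. wb (y - x \<alpha>) * A_eig \<gamma> ms (x \<alpha>)) (\<lambda>\<beta>. wb (y - x \<beta> - \<gamma>) * D_eig ms (x \<beta>))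
       = D_eig ms y * Z"
  shows "subset_sum \<gamma> x (insert i J) (\<lambda>\<alpha>. A_eig \<gamma> ms (x \<alpha>)) (\<lambda>\<beta>. D_eig ms (x \<beta>)) = 0"
proof -
  let ?A = "\<lambda>\<alpha>. A_eig \<gamma> ms (x \<alpha>)" and ?D = "\<lambda>\<alpha>. D_eig ms (x \<alpha>)"
  let ?P = "\<Prod>j\<in>J. wb (x i - x j)"
  have nz: "wb (x i - x j) \<noteq> 0" "wb (x j - x i) \<noteq> 0" if "j \<in> J" for j
    using that assms(2,3) by (metis insert_subset subsetD wb_nz)+
  have "?P * subset_sum \<gamma> x J ?A (\<lambda>\<beta>. ?D \<beta> * ratio \<gamma> (x \<beta> - x i)) =
      subset_sum \<gamma> x J (\<lambda>\<alpha>. wb (x i - x \<alpha>) * ?A \<alpha>) (\<lambda>\<beta>. wb (x i - x \<beta> - \<gamma>) * ?D \<beta>)"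
  proof (rule subset_sum_scale_eq[symmetric, OF assms(1)])
    fix j assume "j \<in> J"
    then show "wb (x i - x j - \<gamma>) * ?D j = wb (x i - x j) * (?D j * ratio \<gamma> (x j - x i))"
      using nz(2)[of j] by (simp add: ratio_def wb_sub_gamma wb_commute[of "x i" "x j"])
  qed simp
  also have "\<dots> = ?D i * Z" by (rule F)
  finally have 1: "?P * subset_sum \<gamma> x J ?A (\<lambda>\<beta>. ?D \<beta> * ratio \<gamma> (x \<beta> - x i)) = ?D i * Z" .
  have "?P * subset_sum \<gamma> x J (\<lambda>\<alpha>. ?A \<alpha> * ratio \<gamma> (x i - x \<alpha>)) ?D =
      subset_sum \<gamma> x J (\<lambda>\<alpha>. wb (x i + \<gamma> - x \<alpha>) * ?A \<alpha>) (\<lambda>\<beta>. wb (x i + \<gamma> - x \<beta> - \<gamma>) * ?D \<beta>)"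
    by (rule subset_sum_scale_eq[symmetric, OF assms(1)]) (use nz in \<open>auto simp: ratio_def wb_add_gamma\<close>)
  also have "\<dots> = ?A i * Z" unfolding F by (simp add: wb_add_gamma)
  finally have 2: "?P * subset_sum \<gamma> x J (\<lambda>\<alpha>. ?A \<alpha> * ratio \<gamma> (x i - x \<alpha>)) ?D = ?A i * Z" .
  have "?P * subset_sum \<gamma> x (insert i J) ?A ?D = ?A i * (?D i * Z) - ?D i * (?A i * Z)"
    unfolding subset_sum_insert[OF assms(1,3)] 1[symmetric] 2[symmetric] by (simp add: algebra_simps)
  moreover have "?P \<noteq> 0" using nz assms(1) by simp
  ultimately show ?thesis by simp
qed

text \<open>Interpolation in the first inhomogeneity, by induction on the size. The induction
  hypothesis has to hold for every \<open>y\<close>, because \<open>subset_sum_zero\<close> uses it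
  at two values other than the current one.\<close>

theorem subset_sum_eq_dwpf:
  assumes "distinct is" "set is \<subseteq> I" "length is = length ms"
  shows "subset_sum \<gamma> x (set is) (\<lambda>\<alpha>. wb (y - x \<alpha>) * A_eig \<gamma> ms (x \<alpha>)) (\<lambda>\<beta>. wb (y - x \<beta> - \<gamma>) * D_eig ms (x \<beta>))
    = D_eig ms y * dwpf \<gamma> ms (map x is)"
  using assms
proof (induction ms arbitrary: "is" y)
  case Nil
  then show ?case by simp
next
  case (Cons m\<^sub>0 ms)
  let ?E = "\<lambda>y m. subset_sum \<gamma> x (set is) (\<lambda>\<alpha>. wb (y - x \<alpha>) * A_eig \<gamma> (m # ms) (x \<alpha>))
      (\<lambda>\<beta>. wb (y - x \<beta> - \<gamma>) * D_eig (m # ms) (x \<beta>)) - D_eig (m # ms) y * dwpf \<gamma> (m # ms) (map x is)"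
  obtain i\<^sub>0 is' where is_Cons: "is = i\<^sub>0 # is'" using Cons.prems(3) by (cases "is") auto
  have card: "card (set is) = Suc (length ms)"
    using Cons.prems by (simp add: distinct_card)
  \<comment> \<open>For such y, the points y and x_j are admissible nodes, one more than the degree;
    the other y follow by continuity at the end.\<close>
  have generic: "?E y m = 0" if y: "\<forall>j\<in>set is. wb (y - x j) \<noteq> 0" for y m
  proof (rule trig_poly_eq_0[where f = "\<lambda>m. ?E y m"])
    \<comment> \<open>\<open>dwpf\<close> has degree one less than the number of rows, and the
      factor b(y - m) of \<open>D_eig\<close> adds one.\<close>
    have "trig_poly (1 + length is') (\<lambda>m. wb (y - m) * (D_eig ms y * dwpf \<gamma> (m # ms) (map x is)))"
      unfolding is_Cons list.map
      using trig_poly_dwpf[of "map x is'" \<gamma> ms "x i\<^sub>0"]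
      by (intro trig_poly_mult trig_poly_wb trig_poly_cmult) simp
    moreover have "1 + length is' = card (set is)" using card Cons.prems(3) is_Cons by simp
    moreover have "trig_poly (card (set is)) (\<lambda>m. subset_sum \<gamma> x (set is) (\<lambda>\<alpha>. wb (y - x \<alpha>) * A_eig \<gamma> (m # ms) (x \<alpha>))
      (\<lambda>\<beta>. wb (y - x \<beta> - \<gamma>) * D_eig (m # ms) (x \<beta>)))"
      unfolding list.map prod_list.Cons
      by (intro trig_poly_cmult trig_poly_multc trig_poly_subset_sum trig_poly_wa trig_poly_wb finite_set)
    ultimately show "trig_poly (card (set is)) (\<lambda>m. ?E y m)"
      by (intro trig_poly_diff) (simp_all add: mult_ac)
    show "finite (insert y (x ` set is))" by simp
    have "y \<notin> x ` set is" using y by (auto simp: wb_def)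
    moreover have "card (x ` set is) = card (set is)"
      using inj_on_subset[OF inj_x Cons.prems(2)] by (rule card_image)
    ultimately show "card (set is) < card (insert y (x ` set is))" by simp
  next
    fix z w assume "z \<in> insert y (x ` set is)" "w \<in> insert y (x ` set is)" "z \<noteq> w"
    then show "sinh (z - w) \<noteq> 0"
      using y wb_nz Cons.prems(2) wb_commute[of w z] unfolding wb_def[symmetric]
      by (auto simp: wb_commute[of "x _" y])
  next
    fix z assume z: "z \<in> insert y (x ` set is)"
    show "?E y z = 0"
    proof (cases "z = y")
      case True
      \<comment> \<open>At m = y the right-hand side contains b(0) = 0. On the left, -a(x_j - y)
        b(x_j - y) is common to both weights, and the remaining sum has one variable more than
        inhomogeneities, so it vanishes.\<close>
      have "subset_sum \<gamma> x (insert i\<^sub>0 (set is')) (\<lambda>\<alpha>. A_eig \<gamma> ms (x \<alpha>)) (\<lambda>\<beta>. D_eig ms (x \<beta>)) = 0"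
        using Cons.prems is_Cons
        by (intro subset_sum_zero[of _ _ _ "dwpf \<gamma> ms (map x is')"] Cons.IH) auto
      moreover have "subset_sum \<gamma> x (set is) (\<lambda>\<alpha>. wb (y - x \<alpha>) * A_eig \<gamma> (y # ms) (x \<alpha>))
          (\<lambda>\<beta>. wb (y - x \<beta> - \<gamma>) * D_eig (y # ms) (x \<beta>)) =
        (\<Prod>j\<in>set is. - (wa \<gamma> (x j - y) * wb (x j - y))) * subset_sum \<gamma> x (set is) (\<lambda>\<alpha>. A_eig \<gamma> ms (x \<alpha>)) (\<lambda>\<beta>. D_eig ms (x \<beta>))"
        by (rule subset_sum_scale_eq) (simp_all add: wb_sub_gamma wb_commute[of y "x _"])
      moreover have "wb (y - y) = 0" by (simp add: wb_def)
      ultimately show ?thesis using True is_Cons by simp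
    next
      case False
      then obtain i where i: "i \<in> set is" "z = x i" using z by blast
      then obtain us vs where "is": "is = us @ i # vs" by (meson split_list)
      let ?J = "set (us @ vs)"
      have J: "set is = insert i ?J" "i \<notin> ?J" using "is" Cons.prems(1) by auto
      have nz: "wb (x j - x i) \<noteq> 0" if "j \<in> ?J" for j
        using that J Cons.prems(2) by (intro wb_nz) auto
      \<comment> \<open>At m = x_i the sum and the partition function freeze alike; the additional
        b(y - x_i) is the factor b(y - m) of \<open>D_eig\<close> on the right-hand side.\<close>
      have "subset_sum \<gamma> x (insert i ?J) (\<lambda>\<alpha>. wb (y - x \<alpha>) * A_eig \<gamma> (x i # ms) (x \<alpha>))
          (\<lambda>\<beta>. wb (y - x \<beta> - \<gamma>) * D_eig (x i # ms) (x \<beta>))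
        = sinh \<gamma> * (wb (y - x i) * A_eig \<gamma> ms (x i)) * (\<Prod>j\<in>?J. wa \<gamma> (x j - x i)) *
          subset_sum \<gamma> x ?J (\<lambda>\<alpha>. wb (y - x \<alpha>) * A_eig \<gamma> ms (x \<alpha>)) (\<lambda>\<beta>. wb (y - x \<beta> - \<gamma>) * D_eig ms (x \<beta>))"
        using J(2) nz by (intro subset_sum_freeze) (simp_all add: mult_ac)
      also have "subset_sum \<gamma> x ?J (\<lambda>\<alpha>. wb (y - x \<alpha>) * A_eig \<gamma> ms (x \<alpha>)) (\<lambda>\<beta>. wb (y - x \<beta> - \<gamma>) * D_eig ms (x \<beta>))
        = D_eig ms y * dwpf \<gamma> ms (map x (us @ vs))"
        using Cons.prems "is" by (intro Cons.IH) auto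
      finally show ?thesis
        using dwpf_freeze_at[of us i vs ms] Cons.prems "is" i J(1) by simp
    qed
  qed
  have "?E y m\<^sub>0 = 0"
  proof (rule continuous_eq_0_of_generic[where f = "\<lambda>y. ?E y m\<^sub>0" and D = "x ` set is"])
    show "continuous_on UNIV (\<lambda>y. ?E y m\<^sub>0)"
      unfolding subset_sum_def wb_def[of "_ - x _"] wb_def[of "_ - x _ - _"]
      by (intro continuous_intros continuous_on_D_eig)
  qed (use generic in \<open>auto simp: wb_def\<close>)
  then show ?case by simp
qed

text \<open>Here the degree in the first inhomogeneity is one less than the number of points, so the
  points themselves suffice as nodes. Size one is covered by the single node at
  \<open>i\<^sub>0\<close>.\<close>

theorem subset_sum_eq_dwpf_Cons:
  assumes "distinct (i\<^sub>0 # is)" "set (i\<^sub>0 # is) \<subseteq> I" "length ms = Suc (length is)"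
  shows "sinh \<gamma> * subset_sum \<gamma> x (set is) (\<lambda>\<alpha>. wa \<gamma> (x i\<^sub>0 - x \<alpha>) * A_eig \<gamma> ms (x \<alpha>))
      (\<lambda>\<beta>. wb (x i\<^sub>0 - x \<beta> - \<gamma>) * D_eig ms (x \<beta>))
    = dwpf \<gamma> ms (map x (i\<^sub>0 # is))"
  using assms
proof (induction ms arbitrary: "is")
  case Nil
  then show ?case by simp
next
  case (Cons m\<^sub>0 ms)
  let ?y = "x i\<^sub>0"
  let ?E = "\<lambda>m. sinh \<gamma> * subset_sum \<gamma> x (set is) (\<lambda>\<alpha>. wa \<gamma> (?y - x \<alpha>) * A_eig \<gamma> (m # ms) (x \<alpha>))
      (\<lambda>\<beta>. wb (?y - x \<beta> - \<gamma>) * D_eig (m # ms) (x \<beta>)) - dwpf \<gamma> (m # ms) (map x (i\<^sub>0 # is))"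
  have card: "card (set is) = length is"
    using Cons.prems by (simp add: distinct_card)
  have "?E m\<^sub>0 = 0"
  proof (rule trig_poly_eq_0[where f = ?E])
    have "trig_poly (card (set is)) (\<lambda>m. sinh \<gamma> * subset_sum \<gamma> x (set is) (\<lambda>\<alpha>. wa \<gamma> (?y - x \<alpha>) * A_eig \<gamma> (m # ms) (x \<alpha>))
      (\<lambda>\<beta>. wb (?y - x \<beta> - \<gamma>) * D_eig (m # ms) (x \<beta>)))"
      unfolding list.map prod_list.Cons
      by (intro trig_poly_cmult trig_poly_multc trig_poly_subset_sum trig_poly_wa trig_poly_wb finite_set)
    then show "trig_poly (length is) (\<lambda>m. ?E m)"
      using trig_poly_dwpf[of "map x is" \<gamma> ms ?y] unfolding card
      by (intro trig_poly_diff) simp_all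
    show "finite (x ` set (i\<^sub>0 # is))" by simp
    have "card (x ` set (i\<^sub>0 # is)) = card (set (i\<^sub>0 # is))"
      using inj_on_subset[OF inj_x Cons.prems(2)] by (rule card_image)
    then show "length is < card (x ` set (i\<^sub>0 # is))"
      using Cons.prems(1) card by simp
  next
    fix z w assume "z \<in> x ` set (i\<^sub>0 # is)" "w \<in> x ` set (i\<^sub>0 # is)" "z \<noteq> w"
    then show "sinh (z - w) \<noteq> 0"
      using wb_nz Cons.prems(2) unfolding wb_def[symmetric] by (metis (no_types, lifting) imageE subsetD)
  next
    fix z assume z: "z \<in> x ` set (i\<^sub>0 # is)"
    show "?E z = 0"
    proof (cases "z = ?y")
      case True
      \<comment> \<open>At this node a(x_j - y) is common to both weights, and what remains is the
        sum of \<open>subset_sum_eq_dwpf\<close> with the free point shifted to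
        \<open>?y + \<gamma>\<close>.\<close>
      have "subset_sum \<gamma> x (set is) (\<lambda>\<alpha>. wa \<gamma> (?y - x \<alpha>) * A_eig \<gamma> (?y # ms) (x \<alpha>))
          (\<lambda>\<beta>. wb (?y - x \<beta> - \<gamma>) * D_eig (?y # ms) (x \<beta>)) =
        (\<Prod>j\<in>set is. wa \<gamma> (x j - ?y)) * subset_sum \<gamma> x (set is) (\<lambda>\<alpha>. wb (?y + \<gamma> - x \<alpha>) * A_eig \<gamma> ms (x \<alpha>))
          (\<lambda>\<beta>. wb (?y + \<gamma> - x \<beta> - \<gamma>) * D_eig ms (x \<beta>))"
        by (rule subset_sum_scale_eq) (simp_all add: wb_sub_gamma wb_add_gamma wb_commute[of ?y "x _"])
      also have "subset_sum \<gamma> x (set is) (\<lambda>\<alpha>. wb (?y + \<gamma> - x \<alpha>) * A_eig \<gamma> ms (x \<alpha>))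
          (\<lambda>\<beta>. wb (?y + \<gamma> - x \<beta> - \<gamma>) * D_eig ms (x \<beta>)) = D_eig ms (?y + \<gamma>) * dwpf \<gamma> ms (map x is)"
        using Cons.prems by (intro subset_sum_eq_dwpf) auto
      also have "D_eig ms (?y + \<gamma>) = A_eig \<gamma> ms ?y" by (simp add: wb_add_gamma)
      finally show ?thesis
        using dwpf_freeze_at[of "[]" i\<^sub>0 "is" ms] Cons.prems True by simp
    next
      case False
      then obtain i where i: "i \<in> set is" "z = x i" using z by auto
      then obtain us vs where "is": "is = us @ i # vs" by (meson split_list)
      let ?J = "set (us @ vs)"
      have J: "set is = insert i ?J" "i \<notin> ?J" using "is" Cons.prems(1) by auto
      have nz: "wb (x j - x i) \<noteq> 0" if "j \<in> ?J" for j
        using that J Cons.prems(2) by (intro wb_nz) auto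
      have "subset_sum \<gamma> x (insert i ?J) (\<lambda>\<alpha>. wa \<gamma> (?y - x \<alpha>) * A_eig \<gamma> (x i # ms) (x \<alpha>))
          (\<lambda>\<beta>. wb (?y - x \<beta> - \<gamma>) * D_eig (x i # ms) (x \<beta>))
        = sinh \<gamma> * (wa \<gamma> (?y - x i) * A_eig \<gamma> ms (x i)) * (\<Prod>j\<in>?J. wa \<gamma> (x j - x i)) *
          subset_sum \<gamma> x ?J (\<lambda>\<alpha>. wa \<gamma> (?y - x \<alpha>) * A_eig \<gamma> ms (x \<alpha>)) (\<lambda>\<beta>. wb (?y - x \<beta> - \<gamma>) * D_eig ms (x \<beta>))"
        using J(2) nz by (intro subset_sum_freeze) (simp_all add: mult_ac)
      moreover have "sinh \<gamma> * subset_sum \<gamma> x ?J (\<lambda>\<alpha>. wa \<gamma> (?y - x \<alpha>) * A_eig \<gamma> ms (x \<alpha>)) (\<lambda>\<beta>. wb (?y - x \<beta> - \<gamma>) * D_eig ms (x \<beta>))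
        = dwpf \<gamma> ms (map x (i\<^sub>0 # us @ vs))"
        using Cons.prems "is" by (intro Cons.IH) auto
      moreover have "i\<^sub>0 \<notin> ?J" using Cons.prems(1) "is" by auto
      ultimately show ?thesis
        using dwpf_freeze_at[of "i\<^sub>0 # us" i vs ms] Cons.prems "is" i J(1) by simp
    qed
  qed
  then show ?case by simp
qed

end

subsection \<open>Determinants of Cauchy type\<close>

text \<open>Block elimination of the first column. The pivot \<open>p\<close> is factored out
  instead of divided by, since it may vanish.\<close>

lemma det_pivot_column:
  fixes M :: "nat \<Rightarrow> nat \<Rightarrow> complex"
  assumes "u 0 = 1" and M0: "\<And>i. i \<le> n \<Longrightarrow> M i 0 = p * u i"
  shows "det (mat (Suc n) (Suc n) (\<lambda>(i, j). M i j)) =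
    p * det (mat n n (\<lambda>(i, j). M (Suc i) (Suc j) - u (Suc i) * M 0 (Suc j)))"
proof -
  let ?S = "mat n n (\<lambda>(i, j). M (Suc i) (Suc j) - u (Suc i) * M 0 (Suc j))"
  let ?c = "mat n 1 (\<lambda>(i, j). u (Suc i))" and ?r = "mat 1 n (\<lambda>(i, j). M 0 (Suc j))"
  let ?p = "mat 1 1 (\<lambda>(i, j). p)"
  let ?L = "four_block_mat (1\<^sub>m 1) (0\<^sub>m 1 n) ?c (1\<^sub>m n)"
  let ?U = "four_block_mat ?p ?r (0\<^sub>m n 1) ?S"
  have LU: "mat (Suc n) (Suc n) (\<lambda>(i, j). M i j) = ?L * ?U"
  proof -
    have "?L * ?U = four_block_mat (1\<^sub>m 1 * ?p + 0\<^sub>m 1 n * 0\<^sub>m n 1) (1\<^sub>m 1 * ?r + 0\<^sub>m 1 n * ?S)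
      (?c * ?p + 1\<^sub>m n * 0\<^sub>m n 1) (?c * ?r + 1\<^sub>m n * ?S)"
      by (rule mult_four_block_mat) auto
    also have "\<dots> = mat (Suc n) (Suc n) (\<lambda>(i, j). M i j)"
    proof (rule eq_matI)
      fix i j assume "i < dim_row (mat (Suc n) (Suc n) (\<lambda>(i, j). M i j))"
        and "j < dim_col (mat (Suc n) (Suc n) (\<lambda>(i, j). M i j))"
      then have ij: "i < Suc n" "j < Suc n" by auto
      show "four_block_mat (1\<^sub>m 1 * ?p + 0\<^sub>m 1 n * 0\<^sub>m n 1) (1\<^sub>m 1 * ?r + 0\<^sub>m 1 n * ?S)
        (?c * ?p + 1\<^sub>m n * 0\<^sub>m n 1) (?c * ?r + 1\<^sub>m n * ?S) $$ (i, j)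
        = mat (Suc n) (Suc n) (\<lambda>(i, j). M i j) $$ (i, j)"
        using ij assms(1) M0[of i] by (cases i; cases j) (auto simp: scalar_prod_def mult_ac)
    qed auto
    finally show ?thesis by simp
  qed
  have "det (?L * ?U) = det ?L * det ?U"
    by (rule det_mult[of _ "1 + n"]) auto
  also have "det ?L = 1"
    using det_four_block_mat_upper_right_zero[of "1\<^sub>m 1" 1 "0\<^sub>m 1 n" n ?c "1\<^sub>m n"] by simp
  also have "det ?U = p * det ?S"
    using det_four_block_mat_lower_left_zero[of ?p 1 ?r n "0\<^sub>m n 1" ?S] by (simp add: det_single)
  finally show ?thesis by (simp only: LU mult_1_left)
qed

text \<open>Linearity in the corner entry; in the induction below, \<open>c\<close> is the diagonal
  weight that is separated from the Cauchy part.\<close>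

lemma det_add_corner:
  fixes M :: "nat \<Rightarrow> nat \<Rightarrow> complex"
  shows "det (mat (Suc n) (Suc n) (\<lambda>(i, j). (if i = 0 \<and> j = 0 then c else 0) + M i j)) =
    c * det (mat n n (\<lambda>(i, j). M (Suc i) (Suc j))) + det (mat (Suc n) (Suc n) (\<lambda>(i, j). M i j))"
proof -
  let ?A = "mat (Suc n) (Suc n) (\<lambda>(i, j). (if i = 0 \<and> j = 0 then c else 0) + M i j)"
  let ?B = "mat (Suc n) (Suc n) (\<lambda>(i, j). M i j)"
  have del: "mat_delete ?A i 0 = mat_delete ?B i 0" for i
    by (rule eq_matI) (auto simp: mat_delete_def)
  have del0: "mat_delete ?B 0 0 = mat n n (\<lambda>(i, j). M (Suc i) (Suc j))"
    by (rule eq_matI) (auto simp: mat_delete_def)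
  have "det ?A = (\<Sum>i<Suc n. ?A $$ (i, 0) * cofactor ?A i 0)"
    by (rule laplace_expansion_column) auto
  also have "\<dots> = (\<Sum>i<Suc n. (if i = 0 then c * det (mat_delete ?B 0 0) else 0) + ?B $$ (i, 0) * cofactor ?B i 0)"
    by (rule sum.cong) (auto simp: cofactor_def del distrib_right)
  also have "\<dots> = c * det (mat_delete ?B 0 0) + (\<Sum>i<Suc n. ?B $$ (i, 0) * cofactor ?B i 0)"
    unfolding sum.distrib by (simp add: sum.delta)
  also have "(\<Sum>i<Suc n. ?B $$ (i, 0) * cofactor ?B i 0) = det ?B"
    by (rule laplace_expansion_column[symmetric]) auto
  finally show ?thesis unfolding del0 .
qed

lemma mat_eqI:
  assumes "\<And>i j. i < n \<Longrightarrow> j < n \<Longrightarrow> M i j = N i j"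
  shows "mat n n (\<lambda>(i, j). M i j) = mat n n (\<lambda>(i, j). N i j)"
  by (rule eq_matI) (simp_all add: assms)

lemma det_mat_eq_sum:
  fixes M :: "nat \<Rightarrow> nat \<Rightarrow> complex"
  shows "det (mat n n (\<lambda>(i, j). M i j)) = (\<Sum>p\<in>{p. p permutes {0..<n}}. signof p * (\<Prod>i = 0..<n. M i (p i)))"
proof -
  have "(\<Prod>i = 0..<n. mat n n (\<lambda>(i, j). M i j) $$ (i, p i)) = (\<Prod>i = 0..<n. M i (p i))"
    if "p permutes {0..<n}" for p
    by (intro prod.cong refl) (use permutes_in_image[OF that] in simp)
  then show ?thesis by (subst det_def'[of _ n]) (auto intro!: sum.cong)
qed

lemma det_diagonal_conjugate:
  fixes N :: "nat \<Rightarrow> nat \<Rightarrow> complex"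
  assumes "\<And>i. i < n \<Longrightarrow> h i \<noteq> 0"
  shows "det (mat n n (\<lambda>(i, j). h i * N i j / h j)) = det (mat n n (\<lambda>(i, j). N i j))"
  unfolding det_mat_eq_sum
proof (intro sum.cong refl arg_cong2[where f = "(*)"])
  fix p assume "p \<in> {p. p permutes {0..<n}}"
  then have p: "p permutes {0..<n}" by simp
  have "(\<Prod>i = 0..<n. h (p i)) = (\<Prod>i = 0..<n. h i)"
    using prod.permute[OF p, of h] by (simp add: o_def)
  moreover have "(\<Prod>i = 0..<n. h i) \<noteq> 0" using assms by simp
  ultimately show "(\<Prod>i = 0..<n. h i * N i (p i) / h (p i)) = (\<Prod>i = 0..<n. N i (p i))"
    by (simp add: prod_dividef prod.distrib)
qed

text \<open>The sign occurs once for the rows and once for the columns. Used to bring the replaced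
  column of \<open>Wimat\<close> to the front.\<close>

lemma det_permute_rows_columns:
  fixes M :: "nat \<Rightarrow> nat \<Rightarrow> complex"
  assumes p: "p permutes {0..<n}"
  shows "det (mat n n (\<lambda>(i, j). M (p i) (p j))) = det (mat n n (\<lambda>(i, j). M i j))"
proof -
  have lt: "p i < n" if "i < n" for i using permutes_in_image[OF p, of i] that by simp
  have rows: "det (mat n n (\<lambda>(i, j). N (p i) j)) = signof p * det (mat n n (\<lambda>(i, j). N i j))"
    for N :: "nat \<Rightarrow> nat \<Rightarrow> complex"
  proof -
    have "mat n n (\<lambda>(i, j). N (p i) j) = mat n n (\<lambda>(i, j). mat n n (\<lambda>(i, j). N i j) $$ (p i, j))"
      by (rule eq_matI) (auto simp: lt)
    then show ?thesis using det_permute_rows[OF _ p, of "mat n n (\<lambda>(i, j). N i j)"] by simp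
  qed
  have tr: "det (mat n n (\<lambda>(i, j). N j i)) = det (mat n n (\<lambda>(i, j). N i j))"
    for N :: "nat \<Rightarrow> nat \<Rightarrow> complex"
  proof -
    have "mat n n (\<lambda>(i, j). N j i) = transpose_mat (mat n n (\<lambda>(i, j). N i j))"
      by (rule eq_matI) auto
    then show ?thesis using det_transpose[of "mat n n (\<lambda>(i, j). N i j)" n] by simp
  qed
  have "det (mat n n (\<lambda>(i, j). M (p i) (p j))) = signof p * det (mat n n (\<lambda>(i, j). M i (p j)))"
    by (rule rows)
  also have "det (mat n n (\<lambda>(i, j). M i (p j))) = det (mat n n (\<lambda>(i, j). M j (p i)))"
    by (rule tr)
  also have "\<dots> = signof p * det (mat n n (\<lambda>(i, j). M j i))"
    by (rule rows[of "\<lambda>i j. M j i"])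
  also have "det (mat n n (\<lambda>(i, j). M j i)) = det (mat n n (\<lambda>(i, j). M i j))"
    by (rule tr)
  finally show ?thesis by (simp add: sign_def)
qed

text \<open>At u = x_s - x_r this is, up to row and column factors, the Cauchy kernel in exp(2 x_s +
  2 \<gamma>) and exp(2 x_r), normalised to 1 at u = 0 when sinh \<gamma> is nonzero.\<close>

definition cauchy :: "complex \<Rightarrow> complex \<Rightarrow> complex" where
  "cauchy \<gamma> u = sinh \<gamma> / wa \<gamma> u"

lemma wa_mult_diff:
  "wa \<gamma> (z - s) * wa \<gamma> (t - r) - wa \<gamma> (z - r) * wa \<gamma> (t - s) = wb (z - t) * wb (s - r)"
proof -
  have nz: "exp z \<noteq> 0" "exp s \<noteq> 0" "exp t \<noteq> 0" "exp r \<noteq> 0" "exp \<gamma> \<noteq> 0" by simp_all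
  show ?thesis
    unfolding wa_def wb_def sinh_field_def exp_add exp_diff exp_minus minus_add_distrib minus_diff_eq
    using nz by (simp add: field_simps)
qed

text \<open>A Schur complement of the Cauchy kernel is the kernel times a factor in s and a factor
  in t, for fixed z and r; this is why elimination preserves the shape of the matrix.\<close>

lemma cauchy_schur:
  assumes "wa \<gamma> (t - s) \<noteq> 0" "wa \<gamma> (z - s) \<noteq> 0" "wa \<gamma> (z - r) \<noteq> 0" "wa \<gamma> (t - r) \<noteq> 0" "sinh \<gamma> \<noteq> 0"
  shows "cauchy \<gamma> (t - s) - cauchy \<gamma> (z - s) / cauchy \<gamma> (z - r) * cauchy \<gamma> (t - r)
    = cauchy \<gamma> (t - s) * (wb (s - r) / wa \<gamma> (z - s)) * (wb (z - t) / wa \<gamma> (t - r))"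
proof -
  have "cauchy \<gamma> (t - s) - cauchy \<gamma> (z - s) / cauchy \<gamma> (z - r) * cauchy \<gamma> (t - r) =
    sinh \<gamma> * (wa \<gamma> (z - s) * wa \<gamma> (t - r) - wa \<gamma> (z - r) * wa \<gamma> (t - s))
      / (wa \<gamma> (t - s) * wa \<gamma> (z - s) * wa \<gamma> (t - r))"
    using assms by (simp add: cauchy_def divide_simps) (simp add: algebra_simps)
  then show ?thesis unfolding wa_mult_diff by (simp add: cauchy_def)
qed

locale generic_points_nz = generic_points +
  assumes sinh_gamma_nz: "sinh \<gamma> \<noteq> 0"
begin

lemma wa_nz': "i \<in> I \<Longrightarrow> j \<in> I \<Longrightarrow> wa \<gamma> (x i - x j) \<noteq> 0"
  using wa_nz sinh_gamma_nz by (cases "i = j") (auto simp: wa_def)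

text \<open>Eliminating a column of Cauchy type leaves, up to conjugation by a diagonal matrix, a matrix
  of the same shape. The node \<open>z\<close> of the eliminated column may differ from the node \<open>e 0\<close> of the
  eliminated row; this covers both matrices of the theorem.\<close>
lemma det_cauchy_step:
  fixes e :: "nat \<Rightarrow> nat"
  assumes e: "inj_on e {..n}" "e ` {..n} \<subseteq> I" "z \<in> I"
    and M0: "\<And>r. r \<le> n \<Longrightarrow> M r 0 = p * cauchy \<gamma> (x z - x (e r)) / cauchy \<gamma> (x z - x (e 0))"
    and M: "\<And>r s. r \<le> n \<Longrightarrow> s < n \<Longrightarrow>
      M r (Suc s) = (if r = Suc s then f (e r) else 0) - cauchy \<gamma> (x (e (Suc s)) - x (e r)) * g (e (Suc s))"
  shows "det (mat (Suc n) (Suc n) (\<lambda>(r, s). M r s)) = p * det (mat n n (\<lambda>(r, s).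
     (if r = s then f (e (Suc r)) else 0) - cauchy \<gamma> (x (e (Suc s)) - x (e (Suc r))) *
        (g (e (Suc s)) * (wb (x (e (Suc s)) - x (e 0)) * wb (x z - x (e (Suc s))) /
           (wa \<gamma> (x z - x (e (Suc s))) * wa \<gamma> (x (e (Suc s)) - x (e 0)))))))"
proof -
  let ?u = "\<lambda>r. cauchy \<gamma> (x z - x (e r)) / cauchy \<gamma> (x z - x (e 0))"
  \<comment> \<open>The row factor left by the elimination; conjugation with the diagonal matrix of
    \<open>?h\<close> moves it to the columns, where it is absorbed into \<open>g\<close>.\<close>
  let ?h = "\<lambda>r. wb (x (e (Suc r)) - x (e 0)) / wa \<gamma> (x z - x (e (Suc r)))"
  let ?N = "\<lambda>r s. (if r = s then f (e (Suc r)) else 0) - cauchy \<gamma> (x (e (Suc s)) - x (e (Suc r))) *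
        (g (e (Suc s)) * (wb (x (e (Suc s)) - x (e 0)) * wb (x z - x (e (Suc s))) /
           (wa \<gamma> (x z - x (e (Suc s))) * wa \<gamma> (x (e (Suc s)) - x (e 0)))))"
  have eI: "e r \<in> I" if "r \<le> n" for r using e(2) that by auto
  have wz: "wa \<gamma> (x z - x (e r)) \<noteq> 0" if "r \<le> n" for r
    using wa_nz' e(3) eI that by auto
  have wa: "wa \<gamma> (x (e s) - x (e r)) \<noteq> 0" if "r \<le> n" "s \<le> n" for r s
    using wa_nz' eI that by auto
  have h: "?h r \<noteq> 0" if "r < n" for r
  proof -
    have "e (Suc r) \<noteq> e 0" using inj_onD[OF e(1), of "Suc r" 0] that by auto
    then show ?thesis using that wb_nz[OF eI eI, of "Suc r" 0] wz[of "Suc r"] by simp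
  qed
  have "det (mat (Suc n) (Suc n) (\<lambda>(r, s). M r s)) =
      p * det (mat n n (\<lambda>(r, s). M (Suc r) (Suc s) - ?u (Suc r) * M 0 (Suc s)))"
  proof (rule det_pivot_column)
    show "?u 0 = 1" using wz[of 0] sinh_gamma_nz by (simp add: cauchy_def)
  qed (simp add: M0)
  also have "mat n n (\<lambda>(r, s). M (Suc r) (Suc s) - ?u (Suc r) * M 0 (Suc s)) =
      mat n n (\<lambda>(r, s). ?h r * ?N r s / ?h s)"
  proof (rule mat_eqI)
    fix r s assume rs: "r < n" "s < n"
    let ?r = "x (e (Suc r))" and ?s = "x (e (Suc s))" and ?G = "g (e (Suc s))"
    let ?d = "if r = s then f (e (Suc r)) else 0"
    let ?w = "wb (x z - ?s) / wa \<gamma> (?s - x (e 0))"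
    have schur: "cauchy \<gamma> (?s - ?r) - ?u (Suc r) * cauchy \<gamma> (?s - x (e 0)) = cauchy \<gamma> (?s - ?r) * ?h r * ?w"
      using rs wa wz sinh_gamma_nz by (intro cauchy_schur) auto
    have "M (Suc r) (Suc s) - ?u (Suc r) * M 0 (Suc s) =
        ?d - (cauchy \<gamma> (?s - ?r) - ?u (Suc r) * cauchy \<gamma> (?s - x (e 0))) * ?G"
      using rs by (simp add: M algebra_simps)
    also have "\<dots> = ?d - cauchy \<gamma> (?s - ?r) * ?h r * ?w * ?G"
      unfolding schur ..
    also have "\<dots> = ?h r * ?d / ?h s - ?h r * (cauchy \<gamma> (?s - ?r) * (?G * (?h s * ?w))) / ?h s"
      using h[OF rs(1)] h[OF rs(2)] by (auto simp: mult_ac)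
    also have "\<dots> = ?h r * ?N r s / ?h s"
      by (simp only: right_diff_distrib diff_divide_distrib times_divide_times_eq)
    finally show "M (Suc r) (Suc s) - ?u (Suc r) * M 0 (Suc s) = ?h r * ?N r s / ?h s" .
  qed
  also have "det \<dots> = det (mat n n (\<lambda>(r, s). ?N r s))"
    using h by (rule det_diagonal_conjugate)
  finally show ?thesis .
qed

text \<open>The induction mirrors \<open>subset_sum_insert\<close>: the diagonal weight in the
  corner gives the subsets without \<open>e 0\<close>, and the remaining Cauchy column, removed by
  \<open>det_cauchy_step\<close>, gives those with \<open>e 0\<close>.\<close>

lemma det_cauchy_eq_subset_sum:
  fixes e :: "nat \<Rightarrow> nat"
  assumes "inj_on e {..<n}" "e ` {..<n} \<subseteq> I"
  shows "det (mat n n (\<lambda>(r, s). (if r = s then f (e r) else 0) - cauchy \<gamma> (x (e s) - x (e r)) *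
      (g (e s) * (\<Prod>k\<in>e ` {..<n} - {e s}. ratio \<gamma> (x (e s) - x k))))) = subset_sum \<gamma> x (e ` {..<n}) f g"
  using assms
proof (induction n arbitrary: e g)
  case 0
  then show ?case by simp
next
  case (Suc n)
  let ?e = "e \<circ> Suc" and ?i = "e 0"
  let ?J = "?e ` {..<n}"
  let ?P = "\<lambda>t. \<Prod>k\<in>insert ?i ?J - {t}. ratio \<gamma> (x t - x k)"
  let ?Q = "\<lambda>t. \<Prod>k\<in>?J - {t}. ratio \<gamma> (x t - x k)"
  have J: "e ` {..<Suc n} = insert ?i ?J"
    by (simp add: lessThan_Suc_eq_insert_0 image_image)
  have inj: "inj_on ?e {..<n}" using Suc.prems(1) by (auto simp: inj_on_def)
  have i: "?i \<notin> ?J" using Suc.prems(1) by (auto simp: inj_on_def)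
  have sub: "?J \<subseteq> I" "?i \<in> I" using Suc.prems(2) J by auto
  have P: "?P t = ratio \<gamma> (x t - x ?i) * ?Q t" if "t \<in> ?J" for t
  proof -
    have "insert ?i ?J - {t} = insert ?i (?J - {t})" using i that by auto
    then show ?thesis using i by simp
  qed
  have Pi: "?P ?i = (\<Prod>k\<in>?J. ratio \<gamma> (x ?i - x k))" using i by simp
  have wJ: "wb (x t - x ?i) \<noteq> 0" "wb (x ?i - x t) \<noteq> 0" "wa \<gamma> (x t - x ?i) \<noteq> 0" "wa \<gamma> (x ?i - x t) \<noteq> 0"
    if "t \<in> ?J" for t
    using that i sub wb_nz[of t ?i] wb_nz[of ?i t] wa_nz'[of t ?i] wa_nz'[of ?i t] by (metis subsetD)+
  let ?F = "\<lambda>r s. (if r = s then f (e r) else 0) - cauchy \<gamma> (x (e s) - x (e r)) * (g (e s) * ?P (e s))"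
  \<comment> \<open>\<open>?M\<close> drops the diagonal weight in the corner only, so its first
    column is purely of Cauchy type.\<close>
  let ?M = "\<lambda>r s. (if r = s \<and> s \<noteq> 0 then f (e r) else 0) - cauchy \<gamma> (x (e s) - x (e r)) * (g (e s) * ?P (e s))"
  have c0: "cauchy \<gamma> 0 = 1" using sinh_gamma_nz by (simp add: cauchy_def wa_def)
  have "mat (Suc n) (Suc n) (\<lambda>(r, s). ?F r s) =
      mat (Suc n) (Suc n) (\<lambda>(r, s). (if r = 0 \<and> s = 0 then f ?i else 0) + ?M r s)"
    by (rule eq_matI) auto
  then have "det (mat (Suc n) (Suc n) (\<lambda>(r, s). ?F r s)) = f ?i * det (mat n n (\<lambda>(r, s). ?M (Suc r) (Suc s)))
      + det (mat (Suc n) (Suc n) (\<lambda>(r, s). ?M r s))"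
    by (simp only: det_add_corner)
  also have "mat n n (\<lambda>(r, s). ?M (Suc r) (Suc s)) = mat n n (\<lambda>(r, s). (if r = s then f (?e r) else 0) -
      cauchy \<gamma> (x (?e s) - x (?e r)) * (g (?e s) * ratio \<gamma> (x (?e s) - x ?i) * ?Q (?e s)))"
  proof (rule mat_eqI)
    fix r s assume rs: "r < n" "s < n"
    then have "?e s \<in> ?J" by auto
    from P[OF this] show "?M (Suc r) (Suc s) = (if r = s then f (?e r) else 0) -
        cauchy \<gamma> (x (?e s) - x (?e r)) * (g (?e s) * ratio \<gamma> (x (?e s) - x ?i) * ?Q (?e s))"
      by simp
  qed
  also have "det \<dots> = subset_sum \<gamma> x ?J f (\<lambda>t. g t * ratio \<gamma> (x t - x ?i))"
    using Suc.IH[OF inj sub(1), of "\<lambda>t. g t * ratio \<gamma> (x t - x ?i)"] by simp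
  also have "det (mat (Suc n) (Suc n) (\<lambda>(r, s). ?M r s)) = - (g ?i * ?P ?i) * det (mat n n (\<lambda>(r, s).
     (if r = s then f (e (Suc r)) else 0) - cauchy \<gamma> (x (e (Suc s)) - x (e (Suc r))) *
        (g (e (Suc s)) * ?P (e (Suc s)) * (wb (x (e (Suc s)) - x ?i) * wb (x ?i - x (e (Suc s))) /
           (wa \<gamma> (x ?i - x (e (Suc s))) * wa \<gamma> (x (e (Suc s)) - x ?i))))))"
    using Suc.prems c0
    by (intro det_cauchy_step[where g = "\<lambda>t. g t * ?P t"]) (auto simp: lessThan_Suc_atMost)
  also have "mat n n (\<lambda>(r, s).
     (if r = s then f (e (Suc r)) else 0) - cauchy \<gamma> (x (e (Suc s)) - x (e (Suc r))) *
        (g (e (Suc s)) * ?P (e (Suc s)) * (wb (x (e (Suc s)) - x ?i) * wb (x ?i - x (e (Suc s))) /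
           (wa \<gamma> (x ?i - x (e (Suc s))) * wa \<gamma> (x (e (Suc s)) - x ?i))))) =
    mat n n (\<lambda>(r, s). (if r = s then f (?e r) else 0) -
      cauchy \<gamma> (x (?e s) - x (?e r)) * (g (?e s) / ratio \<gamma> (x ?i - x (?e s)) * ?Q (?e s)))"
  proof (rule mat_eqI)
    fix r s assume rs: "r < n" "s < n"
    let ?s = "e (Suc s)"
    have s: "?s \<in> ?J" using rs by auto
    \<comment> \<open>The factor for \<open>?i\<close> in \<open>?P\<close> cancels against the b/a
      of the same argument from the elimination; the other b/a is the inverse ratio.\<close>
    have "g ?s * ?P ?s * (wb (x ?s - x ?i) * wb (x ?i - x ?s)) / (wa \<gamma> (x ?i - x ?s) * wa \<gamma> (x ?s - x ?i))
      = g ?s * ?Q ?s / ratio \<gamma> (x ?i - x ?s)"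
      unfolding P[OF s] using wJ[OF s] by (simp add: ratio_def field_simps)
    then show "(if r = s then f (e (Suc r)) else 0) - cauchy \<gamma> (x (e (Suc s)) - x (e (Suc r))) *
        (g (e (Suc s)) * ?P (e (Suc s)) * (wb (x (e (Suc s)) - x ?i) * wb (x ?i - x (e (Suc s))) /
           (wa \<gamma> (x ?i - x (e (Suc s))) * wa \<gamma> (x (e (Suc s)) - x ?i)))) =
      (if r = s then f (?e r) else 0) -
      cauchy \<gamma> (x (?e s) - x (?e r)) * (g (?e s) / ratio \<gamma> (x ?i - x (?e s)) * ?Q (?e s))"
      by (simp add: mult_ac)
  qed
  also have "det \<dots> = subset_sum \<gamma> x ?J f (\<lambda>t. g t / ratio \<gamma> (x ?i - x t))"
    using Suc.IH[OF inj sub(1), of "\<lambda>t. g t / ratio \<gamma> (x ?i - x t)"] by simp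
  also have "- (g ?i * ?P ?i) * \<dots> = - (g ?i * (?P ?i * \<dots>))" by simp
  \<comment> \<open>Spread over the indices of \<open>?J\<close>, the product \<open>?P ?i\<close>
    cancels the division in the second weight and multiplies the first, as
    \<open>subset_sum_insert\<close> demands.\<close>
  also have "?P ?i * subset_sum \<gamma> x ?J f (\<lambda>t. g t / ratio \<gamma> (x ?i - x t)) =
      subset_sum \<gamma> x ?J (\<lambda>t. f t * ratio \<gamma> (x ?i - x t)) g"
    unfolding Pi by (rule subset_sum_scale_eq[symmetric]) (use wJ in \<open>auto simp: ratio_def\<close>)
  finally show ?case
    unfolding J subset_sum_insert[OF finite_imageI[OF finite_lessThan] i]
    by (simp only: diff_conv_add_uminus)
qed
end

subsection \<open>The determinant formulas\<close>

lemma A_eig_map: "A_eig \<gamma> (map \<mu> [1..<L+1]) z = (\<Prod>k\<in>{1..L}. wa \<gamma> (z - \<mu> k))"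
  using prod.distinct_set_conv_list[of "[1..<L+1]" "\<lambda>k. wa \<gamma> (z - \<mu> k)"]
  by (simp add: o_def atLeastLessThanSuc_atLeastAtMost del: upt_Suc)

lemma D_eig_map: "D_eig (map \<mu> [1..<L+1]) z = (\<Prod>k\<in>{1..L}. wb (z - \<mu> k))"
  using prod.distinct_set_conv_list[of "[1..<L+1]" "\<lambda>k. wb (z - \<mu> k)"]
  by (simp add: o_def atLeastLessThanSuc_atLeastAtMost del: upt_Suc)

locale dwpf_points = generic_points_nz \<gamma> x "{0..L}" for \<gamma> x and L :: nat +
  fixes \<mu> :: "nat \<Rightarrow> complex"
  assumes mu_nz: "k \<in> {1..L} \<Longrightarrow> wb (x 0 - \<mu> k) \<noteq> 0"
begin

abbreviation "A z \<equiv> A_eig \<gamma> (map \<mu> [1..<L+1]) z"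
abbreviation "D z \<equiv> D_eig (map \<mu> [1..<L+1]) z"

lemma zero_in: "0 \<in> {0..L}"
  by simp

lemma D_nz: "D (x 0) \<noteq> 0"
  unfolding D_eig_map using mu_nz by simp

lemma prod_ratio: "(\<Prod>k\<in>{1..L}. wb (x 0 - x k) / wb (x 0 - \<mu> k)) = (\<Prod>k\<in>{1..L}. wb (x 0 - x k)) / D (x 0)"
  unfolding D_eig_map by (rule prod_dividef)

text \<open>Completing the product by k = \<alpha> turns c/b into a Cauchy entry: W is a diagonal
  matrix minus a Cauchy matrix with weighted columns.\<close>

lemma Wentry_eq:
  assumes "\<alpha> \<in> {1..L}" "\<beta> \<in> {1..L}"
  shows "Wentry \<gamma> \<mu> L x \<alpha> \<beta> = (if \<alpha> = \<beta> then A (x \<alpha>) else 0) - cauchy \<gamma> (x \<beta> - x \<alpha>) *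
    (D (x \<beta>) * ratio \<gamma> (x \<beta> - x 0) * (\<Prod>k\<in>{1..L} - {\<beta>}. ratio \<gamma> (x \<beta> - x k)))"
proof (cases "\<alpha> = \<beta>")
  case True
  have "{0..L} - {\<alpha>} = insert 0 ({1..L} - {\<alpha>})" using assms by auto
  moreover have "cauchy \<gamma> 0 = 1" using sinh_gamma_nz by (simp add: cauchy_def wa_def)
  ultimately show ?thesis
    using True unfolding Wentry_def A_eig_map D_eig_map by (simp add: ratio_def)
next
  case False
  have 0: "{0..L} - {\<alpha>, \<beta>} = insert 0 ({1..L} - {\<alpha>, \<beta>})"
    and 1: "{1..L} - {\<beta>} = insert \<alpha> ({1..L} - {\<alpha>, \<beta>})" using assms False by auto
  let ?R = "\<Prod>k\<in>{1..L} - {\<alpha>, \<beta>}. ratio \<gamma> (x \<beta> - x k)"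
  have "Wentry \<gamma> \<mu> L x \<alpha> \<beta> = sinh \<gamma> / wb (x \<alpha> - x \<beta>) * D (x \<beta>) * (ratio \<gamma> (x \<beta> - x 0) * ?R)"
    using False unfolding Wentry_def D_eig_map 0 by (simp add: wc_def ratio_def)
  also have "sinh \<gamma> / wb (x \<alpha> - x \<beta>) = - (cauchy \<gamma> (x \<beta> - x \<alpha>) * ratio \<gamma> (x \<beta> - x \<alpha>))"
    using assms False wb_nz[of \<beta> \<alpha>] wa_nz[of \<beta> \<alpha>]
    by (simp add: cauchy_def ratio_def wb_commute[of "x \<alpha>" "x \<beta>"])
  also have "- (cauchy \<gamma> (x \<beta> - x \<alpha>) * ratio \<gamma> (x \<beta> - x \<alpha>)) * D (x \<beta>) * (ratio \<gamma> (x \<beta> - x 0) * ?R)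
    = - (cauchy \<gamma> (x \<beta> - x \<alpha>) * (D (x \<beta>) * ratio \<gamma> (x \<beta> - x 0) * (ratio \<gamma> (x \<beta> - x \<alpha>) * ?R)))"
    by (simp add: mult_ac)
  also have "ratio \<gamma> (x \<beta> - x \<alpha>) * ?R = (\<Prod>k\<in>{1..L} - {\<beta>}. ratio \<gamma> (x \<beta> - x k))"
    unfolding 1 by simp
  finally show ?thesis using False by simp
qed

text \<open>The replaced column is of Cauchy type with node x_0 instead of x_i, the case of
  \<open>det_cauchy_step\<close> in which \<open>z\<close> differs from \<open>e 0\<close>.\<close>

lemma Wcol_eq:
  assumes "\<alpha> \<in> {1..L}"
  shows "Wcol \<gamma> \<mu> L x \<alpha> = cauchy \<gamma> (x 0 - x \<alpha>) * (D (x 0) * (\<Prod>k\<in>{1..L}. ratio \<gamma> (x 0 - x k)))"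
proof -
  have 1: "{1..L} = insert \<alpha> ({1..L} - {\<alpha>})" using assms by auto
  have "(\<Prod>k\<in>{1..L}. ratio \<gamma> (x 0 - x k)) = ratio \<gamma> (x 0 - x \<alpha>) * (\<Prod>k\<in>{1..L} - {\<alpha>}. ratio \<gamma> (x 0 - x k))"
    by (subst 1, subst prod.insert) auto
  then show ?thesis
    using assms wb_nz[of 0 \<alpha>] wa_nz[of 0 \<alpha>] unfolding Wcol_def D_eig_map
    by (simp add: wc_def cauchy_def ratio_def)
qed

lemma wb_ratio:
  assumes "\<beta> \<in> {1..L}"
  shows "wb (x 0 - x \<beta>) * ratio \<gamma> (x \<beta> - x 0) = wb (x 0 - x \<beta> - \<gamma>)"
  using assms wb_nz[of \<beta> 0]
  by (simp add: ratio_def wb_sub_gamma wb_commute[of "x 0" "x \<beta>"])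

lemma Zdw_eq_det_Wmat:
  "Zdw \<gamma> \<mu> L x = det (Wmat \<gamma> \<mu> L x) * (\<Prod>k\<in>{1..L}. wb (x 0 - x k) / wb (x 0 - \<mu> k))"
proof -
  let ?g = "\<lambda>\<beta>. D (x \<beta>) * ratio \<gamma> (x \<beta> - x 0)"
  have img: "Suc ` {..<L} = {1..L}" by (auto simp: image_iff Suc_le_eq gr0_conv_Suc)
  have "Wmat \<gamma> \<mu> L x = mat L L (\<lambda>(r, s). (if r = s then A (x (Suc r)) else 0) -
      cauchy \<gamma> (x (Suc s) - x (Suc r)) * (?g (Suc s) * (\<Prod>k\<in>Suc ` {..<L} - {Suc s}. ratio \<gamma> (x (Suc s) - x k))))"
    unfolding Wmat_def img
  proof (rule mat_eqI)
    fix r s assume "r < L" "s < L"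
    then show "Wentry \<gamma> \<mu> L x (r + 1) (s + 1) = (if r = s then A (x (Suc r)) else 0) -
      cauchy \<gamma> (x (Suc s) - x (Suc r)) * (?g (Suc s) * (\<Prod>k\<in>{1..L} - {Suc s}. ratio \<gamma> (x (Suc s) - x k)))"
      using Wentry_eq[of "Suc r" "Suc s"] by simp
  qed
  then have "det (Wmat \<gamma> \<mu> L x) = subset_sum \<gamma> x {1..L} (\<lambda>\<alpha>. A (x \<alpha>)) ?g"
    using det_cauchy_eq_subset_sum[of Suc L "\<lambda>\<alpha>. A (x \<alpha>)" ?g] img by auto
  \<comment> \<open>By \<open>wb_ratio\<close>, spreading the prefactor over the indices turns the k
    = 0 ratio in each column of W into the shift by \<gamma>.\<close>
  then have "(\<Prod>k\<in>{1..L}. wb (x 0 - x k)) * det (Wmat \<gamma> \<mu> L x) =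
      subset_sum \<gamma> x {1..L} (\<lambda>\<alpha>. wb (x 0 - x \<alpha>) * A (x \<alpha>)) (\<lambda>\<beta>. wb (x 0 - x \<beta> - \<gamma>) * D (x \<beta>))"
    by (simp only:) (rule subset_sum_scale_eq[symmetric], simp_all add: wb_ratio[symmetric] mult_ac)
  also have "\<dots> = D (x 0) * Zdw \<gamma> \<mu> L x"
    using subset_sum_eq_dwpf[of "[1..<L+1]" "map \<mu> [1..<L+1]" "x 0"]
    by (simp add: Zdw_eq_dwpf atLeastLessThanSuc_atLeastAtMost del: upt_Suc)
  finally show ?thesis using D_nz unfolding prod_ratio by (simp add: field_simps)
qed

lemma Zdw_upd_eq_det_Wimat:
  assumes i: "1 \<le> i" "i \<le> L"
  shows "Zdw \<gamma> \<mu> L (x(i := x 0)) =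
    det (Wimat \<gamma> \<mu> L x i) * (\<Prod>k\<in>{1..L}. wb (x 0 - x k) / wb (x 0 - \<mu> k))"
proof -
  obtain n where L: "L = Suc n" using i by (cases L) auto
  let ?J = "{1..L} - {i}"
  let ?P = "\<lambda>\<beta>. \<Prod>k\<in>{1..L} - {\<beta>}. ratio \<gamma> (x \<beta> - x k)"
  \<comment> \<open>The replaced column has position i - 1 counted from 0; the swap brings it to the
    front, and \<open>e\<close> converts back to indices from 1.\<close>
  define \<pi> where "\<pi> = transpose 0 (i - 1)"
  define e where "e r = Suc (\<pi> r)" for r
  have \<pi>: "\<pi> permutes {0..<L}" unfolding \<pi>_def using i by (intro permutes_swap_id) auto
  have e0: "e 0 = i" using i by (simp add: e_def \<pi>_def)
  have inj: "inj e" unfolding e_def using permutes_inj[OF \<pi>] by (auto simp: inj_def)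
  have img: "e ` {..<L} = {1..L}"
  proof -
    have "e ` {..<L} = Suc ` (\<pi> ` {0..<L})" by (auto simp: e_def atLeast0LessThan)
    also have "\<dots> = {1..L}" unfolding permutes_image[OF \<pi>] by (auto simp: image_iff Suc_le_eq gr0_conv_Suc)
    finally show ?thesis .
  qed
  have eL: "e r \<in> {1..L}" if "r \<le> n" for r using img that L by auto
  have J: "(e \<circ> Suc) ` {..<n} = ?J"
  proof -
    have "e ` {..<L} = insert i ((e \<circ> Suc) ` {..<n})"
      unfolding L by (simp add: lessThan_Suc_eq_insert_0 image_image e0)
    moreover have "i \<notin> (e \<circ> Suc) ` {..<n}" using inj e0 by (auto simp: inj_def)
    ultimately show ?thesis using img by auto
  qed
  define M where "M r s = (if s = 0 then Wcol \<gamma> \<mu> L x (e r) else Wentry \<gamma> \<mu> L x (e r) (e s))" for r s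
  \<comment> \<open>The entry of the replaced column in row i, which the swap puts into the
    corner.\<close>
  define p where "p = cauchy \<gamma> (x 0 - x i) * (D (x 0) * (\<Prod>k\<in>{1..L}. ratio \<gamma> (x 0 - x k)))"
  let ?f = "\<lambda>\<alpha>. A (x \<alpha>)" and ?g = "\<lambda>\<beta>. D (x \<beta>) * ratio \<gamma> (x \<beta> - x 0) * ?P \<beta>"
  let ?g' = "\<lambda>\<beta>. D (x \<beta>) * ratio \<gamma> (x \<beta> - x 0) / ratio \<gamma> (x 0 - x \<beta>)"
  have c_nz: "cauchy \<gamma> (x 0 - x i) \<noteq> 0" using wa_nz'[of 0 i] i sinh_gamma_nz by (simp add: cauchy_def)
  have "det (Wimat \<gamma> \<mu> L x i) = det (mat L L (\<lambda>(r, s). M r s))"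
  proof -
    have "det (mat L L (\<lambda>(r, s). M r s)) = det (mat L L (\<lambda>(r, s).
       (\<lambda>r s. if s + 1 = i then Wcol \<gamma> \<mu> L x (r + 1) else Wentry \<gamma> \<mu> L x (r + 1) (s + 1)) (\<pi> r) (\<pi> s)))"
    proof (rule arg_cong[where f = det], rule mat_eqI)
      fix r s
      have "e s = i \<longleftrightarrow> s = 0" using inj e0 by (auto simp: inj_def)
      then show "M r s = (\<lambda>r s. if s + 1 = i then Wcol \<gamma> \<mu> L x (r + 1) else Wentry \<gamma> \<mu> L x (r + 1) (s + 1)) (\<pi> r) (\<pi> s)"
        by (simp add: M_def e_def)
    qed
    also have "\<dots> = det (mat L L (\<lambda>(r, s).
       (\<lambda>r s. if s + 1 = i then Wcol \<gamma> \<mu> L x (r + 1) else Wentry \<gamma> \<mu> L x (r + 1) (s + 1)) r s))"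
      by (rule det_permute_rows_columns[OF \<pi>])
    finally show ?thesis by (simp add: Wimat_def)
  qed
  also have "\<dots> = det (mat (Suc n) (Suc n) (\<lambda>(r, s). M r s))" by (simp only: L)
  also have "\<dots> = p * det (mat n n (\<lambda>(r, s).
     (if r = s then ?f (e (Suc r)) else 0) - cauchy \<gamma> (x (e (Suc s)) - x (e (Suc r))) *
        (?g (e (Suc s)) * (wb (x (e (Suc s)) - x (e 0)) * wb (x 0 - x (e (Suc s))) /
           (wa \<gamma> (x 0 - x (e (Suc s))) * wa \<gamma> (x (e (Suc s)) - x (e 0)))))))"
  proof (rule det_cauchy_step[where z = 0 and p = p and e = e and M = M and f = ?f and g = ?g])
    show "inj_on e {..n}" using inj by (rule inj_on_subset) simp
    show "e ` {..n} \<subseteq> {0..L}" using eL by fastforce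
    show "0 \<in> {0..L}" by simp
    show "M r 0 = p * cauchy \<gamma> (x 0 - x (e r)) / cauchy \<gamma> (x 0 - x (e 0))" if "r \<le> n" for r
      using Wcol_eq[OF eL[OF that]] c_nz unfolding M_def p_def e0 by simp
    show "M r (Suc s) = (if r = Suc s then ?f (e r) else 0) - cauchy \<gamma> (x (e (Suc s)) - x (e r)) * ?g (e (Suc s))"
      if "r \<le> n" "s < n" for r s
      using Wentry_eq[of "e r" "e (Suc s)"] eL[of r] eL[of "Suc s"] that inj
      by (simp add: M_def inj_eq)
  qed
  also have "mat n n (\<lambda>(r, s).
     (if r = s then ?f (e (Suc r)) else 0) - cauchy \<gamma> (x (e (Suc s)) - x (e (Suc r))) *
        (?g (e (Suc s)) * (wb (x (e (Suc s)) - x (e 0)) * wb (x 0 - x (e (Suc s))) /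
           (wa \<gamma> (x 0 - x (e (Suc s))) * wa \<gamma> (x (e (Suc s)) - x (e 0)))))) =
    mat n n (\<lambda>(r, s). (if r = s then ?f ((e \<circ> Suc) r) else 0) - cauchy \<gamma> (x ((e \<circ> Suc) s) - x ((e \<circ> Suc) r)) *
        (?g' ((e \<circ> Suc) s) * (\<Prod>k\<in>(e \<circ> Suc) ` {..<n} - {(e \<circ> Suc) s}. ratio \<gamma> (x ((e \<circ> Suc) s) - x k))))"
  proof (rule mat_eqI)
    fix r s assume rs: "r < n" "s < n"
    let ?s = "e (Suc s)"
    have s: "?s \<in> {1..L}" "?s \<noteq> i" using eL[of "Suc s"] rs inj e0 by (auto simp: inj_def)
    have "{1..L} - {?s} = insert i (?J - {?s})" using s i by auto
    then have P: "?P ?s = ratio \<gamma> (x ?s - x i) * (\<Prod>k\<in>?J - {?s}. ratio \<gamma> (x ?s - x k))"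
      by simp
    \<comment> \<open>The factor k = i of the product cancels, so x_i drops out of the reduced
      determinant.\<close>
    have "?g ?s * (wb (x ?s - x i) * wb (x 0 - x ?s) / (wa \<gamma> (x 0 - x ?s) * wa \<gamma> (x ?s - x i)))
      = ?g' ?s * (\<Prod>k\<in>?J - {?s}. ratio \<gamma> (x ?s - x k))"
      unfolding P using s i wa_nz[of ?s i] wb_nz[of ?s i] by (simp add: ratio_def[of _ "x ?s - x i"] ratio_def[of _ "x 0 - x ?s"])
    then show "(if r = s then ?f (e (Suc r)) else 0) - cauchy \<gamma> (x (e (Suc s)) - x (e (Suc r))) *
        (?g (e (Suc s)) * (wb (x (e (Suc s)) - x (e 0)) * wb (x 0 - x (e (Suc s))) /
           (wa \<gamma> (x 0 - x (e (Suc s))) * wa \<gamma> (x (e (Suc s)) - x (e 0))))) =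
      (if r = s then ?f ((e \<circ> Suc) r) else 0) - cauchy \<gamma> (x ((e \<circ> Suc) s) - x ((e \<circ> Suc) r)) *
        (?g' ((e \<circ> Suc) s) * (\<Prod>k\<in>(e \<circ> Suc) ` {..<n} - {(e \<circ> Suc) s}. ratio \<gamma> (x ((e \<circ> Suc) s) - x k)))"
      unfolding J e0 by (simp only: o_apply)
  qed
  also have "det \<dots> = subset_sum \<gamma> x ?J ?f ?g'"
  proof -
    have "inj_on (e \<circ> Suc) {..<n}" using inj by (auto simp: inj_def inj_on_def)
    moreover have "(e \<circ> Suc) ` {..<n} \<subseteq> {0..L}" unfolding J by auto
    ultimately have "det (mat n n (\<lambda>(r, s). (if r = s then ?f ((e \<circ> Suc) r) else 0) -
        cauchy \<gamma> (x ((e \<circ> Suc) s) - x ((e \<circ> Suc) r)) *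
        (?g' ((e \<circ> Suc) s) * (\<Prod>k\<in>(e \<circ> Suc) ` {..<n} - {(e \<circ> Suc) s}. ratio \<gamma> (x ((e \<circ> Suc) s) - x k)))))
      = subset_sum \<gamma> x ((e \<circ> Suc) ` {..<n}) ?f ?g'"
      by (rule det_cauchy_eq_subset_sum[where e = "e \<circ> Suc" and f = ?f and g = ?g'])
    then show ?thesis unfolding J .
  qed
  finally have det: "det (Wimat \<gamma> \<mu> L x i) = p * subset_sum \<gamma> x ?J ?f ?g'" .

  \<comment> \<open>The prefactor loses x_i as well: a(x_0 - x_i) cancels against the denominator of
    \<open>cauchy\<close>.\<close>
  have pP: "p * (\<Prod>k\<in>{1..L}. wb (x 0 - x k)) = D (x 0) * (sinh \<gamma> * (\<Prod>k\<in>?J. wa \<gamma> (x 0 - x k)))"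
  proof -
    have "(\<Prod>k\<in>{1..L}. ratio \<gamma> (x 0 - x k)) * (\<Prod>k\<in>{1..L}. wb (x 0 - x k)) = (\<Prod>k\<in>{1..L}. wa \<gamma> (x 0 - x k))"
      unfolding prod.distrib[symmetric] by (intro prod.cong refl) (use wb_nz[of 0] in \<open>simp add: ratio_def\<close>)
    also have "\<dots> = wa \<gamma> (x 0 - x i) * (\<Prod>k\<in>?J. wa \<gamma> (x 0 - x k))"
      using i by (intro prod.remove) auto
    finally show ?thesis using wa_nz'[of 0 i] i
      unfolding p_def cauchy_def by (simp add: mult.assoc)
  qed
  \<comment> \<open>Spreading the factors a(x_0 - x_k) over the indices produces the sum of
    \<open>subset_sum_eq_dwpf_Cons\<close> with 0 as the distinguished index.\<close>
  have "(\<Prod>k\<in>?J. wa \<gamma> (x 0 - x k)) * subset_sum \<gamma> x ?J ?f ?g' =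
    subset_sum \<gamma> x ?J (\<lambda>\<alpha>. wa \<gamma> (x 0 - x \<alpha>) * A (x \<alpha>)) (\<lambda>\<beta>. wb (x 0 - x \<beta> - \<gamma>) * D (x \<beta>))"
  proof (rule subset_sum_scale_eq[symmetric])
    fix \<beta> assume "\<beta> \<in> ?J"
    then have b: "\<beta> \<in> {1..L}" by simp
    then show "wb (x 0 - x \<beta> - \<gamma>) * D (x \<beta>) = wa \<gamma> (x 0 - x \<beta>) * ?g' \<beta>"
      using wb_ratio[OF b] wa_nz'[of 0 \<beta>] by (simp add: ratio_def[of _ "x 0 - x \<beta>"] mult_ac)
  qed auto
  note scaled = this
  let ?T = "subset_sum \<gamma> x ?J (\<lambda>\<alpha>. wa \<gamma> (x 0 - x \<alpha>) * A (x \<alpha>)) (\<lambda>\<beta>. wb (x 0 - x \<beta> - \<gamma>) * D (x \<beta>))"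
  have "p * subset_sum \<gamma> x ?J ?f ?g' * (\<Prod>k\<in>{1..L}. wb (x 0 - x k)) =
      (p * (\<Prod>k\<in>{1..L}. wb (x 0 - x k))) * subset_sum \<gamma> x ?J ?f ?g'"
    by (simp only: mult_ac)
  then have S: "p * subset_sum \<gamma> x ?J ?f ?g' * (\<Prod>k\<in>{1..L}. wb (x 0 - x k)) = D (x 0) * (sinh \<gamma> * ?T)"
    unfolding pP by (simp only: mult.assoc scaled)

  define us vs where "us = [1..<i]" and "vs = [Suc i..<L+1]"
  have split: "[1..<L+1] = us @ i # vs"
    unfolding us_def vs_def using i upt_add_eq_append[of 1 i "L + 1 - i"] upt_conv_Cons[of i "L+1"]
    by (simp del: upt_Suc)
  have set: "set (us @ vs) = ?J" "distinct (us @ vs)" "i \<notin> set us" "i \<notin> set vs" "0 \<notin> set (us @ vs)"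
    unfolding us_def vs_def using i by auto
  have mp: "map (x(i := x 0)) [1..<L+1] = map x us @ x 0 # map x vs"
    unfolding split by (simp only: map_append list.map fun_upd_same map_fun_upd[OF set(3)] map_fun_upd[OF set(4)])
  have "set us \<subseteq> {0..L}"
    using i unfolding us_def by (simp add: subset_iff)
  then have nz: "wa \<gamma> (u - x 0) \<noteq> 0" if "u \<in> x ` set us" for u
    using that wa_nz'[OF _ zero_in] by blast
  have "dwpf \<gamma> (map \<mu> [1..<L+1]) (map x us @ x 0 # map x vs) =
      dwpf \<gamma> (map \<mu> [1..<L+1]) (x 0 # map x us @ map x vs)"
    by (rule dwpf_move_to_front) (unfold set_map, rule ballI, rule nz)
  then have "Zdw \<gamma> \<mu> L (x(i := x 0)) = dwpf \<gamma> (map \<mu> [1..<L+1]) (x 0 # map x (us @ vs))"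
    unfolding Zdw_eq_dwpf mp map_append .
  also have "\<dots> = sinh \<gamma> * subset_sum \<gamma> x ?J (\<lambda>\<alpha>. wa \<gamma> (x 0 - x \<alpha>) * A (x \<alpha>)) (\<lambda>\<beta>. wb (x 0 - x \<beta> - \<gamma>) * D (x \<beta>))"
  proof -
    have d: "distinct (0 # us @ vs)" using set(2,5) by (simp only: distinct.simps not_False_eq_True simp_thms)
    have sub: "set (0 # us @ vs) \<subseteq> {0..L}"
      using i unfolding us_def vs_def by (auto simp del: upt_Suc)
    have "Suc (length (us @ vs)) = length [1..<L+1]"
      unfolding split by (simp only: length_append length_Cons add_Suc_right)
    then have len: "length (map \<mu> [1..<L+1]) = Suc (length (us @ vs))"
      by (simp only: length_map)
    show ?thesis
      using subset_sum_eq_dwpf_Cons[OF d sub len] unfolding set(1) list.map by (rule sym)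
  qed
  finally have "Zdw \<gamma> \<mu> L (x(i := x 0)) = sinh \<gamma> * ?T" .
  moreover have "det (Wimat \<gamma> \<mu> L x i) * ((\<Prod>k\<in>{1..L}. wb (x 0 - x k)) / D (x 0)) = sinh \<gamma> * ?T"
    unfolding det times_divide_eq_right S using D_nz by (rule nonzero_mult_div_cancel_left)
  ultimately show ?thesis unfolding prod_ratio by (simp only:)
qed

end

section \<open>Continuity in \<gamma> and removal of its exceptional values\<close>

lemma continuous_on_Rmat: "continuous_on UNIV (\<lambda>\<gamma>. Rmat \<gamma> x r c)"
proof -
  obtain a s a' s' where rc: "r = (a, s)" "c = (a', s')" by fastforce
  have wa: "continuous_on UNIV (\<lambda>\<gamma>. wa \<gamma> x)" and wc: "continuous_on UNIV (\<lambda>\<gamma>. wc \<gamma> x)"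
    unfolding wa_def wc_def by (intro continuous_intros)+
  have cond: "continuous_on UNIV (\<lambda>\<gamma>. if P then f \<gamma> else g \<gamma>)"
    if "continuous_on UNIV f" "continuous_on UNIV g" for P and f g :: "complex \<Rightarrow> complex"
    using that by (cases P) simp_all
  show ?thesis
    unfolding rc Rmat_def prod.case by (intro cond wa wc continuous_on_const)
qed

lemma continuous_on_row_transfer: "continuous_on UNIV (\<lambda>\<gamma>. row_transfer \<gamma> ms x a \<sigma> a' \<sigma>')"
proof (induction ms arbitrary: a \<sigma> \<sigma>')
  case (Cons m ms)
  show ?case unfolding row_transfer.simps by (intro continuous_intros continuous_on_Rmat Cons)
qed simp

lemma continuous_on_Bprod: "continuous_on UNIV (\<lambda>\<gamma>. Bprod \<gamma> ms xs \<sigma> \<sigma>')"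
proof (induction xs arbitrary: \<sigma>)
  case (Cons x xs)
  show ?case unfolding Bprod.simps by (intro continuous_intros continuous_on_row_transfer Cons)
qed simp

lemma continuous_on_Zdw: "continuous_on UNIV (\<lambda>\<gamma>. Zdw \<gamma> \<mu> L x)"
  unfolding Zdw_eq_dwpf dwpf_def by (rule continuous_on_Bprod)

lemma continuous_on_det_mat:
  fixes M :: "complex \<Rightarrow> nat \<Rightarrow> nat \<Rightarrow> complex"
  assumes "\<And>i j. continuous_on UNIV (\<lambda>t. M t i j)"
  shows "continuous_on UNIV (\<lambda>t. det (mat n n (\<lambda>(i, j). M t i j)))"
  unfolding det_mat_eq_sum by (intro continuous_intros assms)

text \<open>The denominators contain only b, hence no \<gamma>, and act as constants.\<close>

lemma continuous_on_Wentry: "continuous_on UNIV (\<lambda>\<gamma>. Wentry \<gamma> \<mu> L x \<alpha> \<beta>)"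
  unfolding Wentry_def wa_def wc_def divide_inverse
  by (cases "\<beta> = \<alpha>") (simp_all, (intro continuous_intros)+)

lemma continuous_on_Wcol: "continuous_on UNIV (\<lambda>\<gamma>. Wcol \<gamma> \<mu> L x \<alpha>)"
  unfolding Wcol_def wa_def wc_def divide_inverse by (intro continuous_intros)

lemma continuous_on_det_Wmat: "continuous_on UNIV (\<lambda>\<gamma>. det (Wmat \<gamma> \<mu> L x))"
  unfolding Wmat_def by (intro continuous_on_det_mat continuous_on_Wentry)

lemma continuous_on_det_Wimat: "continuous_on UNIV (\<lambda>\<gamma>. det (Wimat \<gamma> \<mu> L x i))"
proof -
  have "continuous_on UNIV (\<lambda>\<gamma>. if s + 1 = i then Wcol \<gamma> \<mu> L x (r + 1) else Wentry \<gamma> \<mu> L x (r + 1) (s + 1))" for r s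
    by (cases "s + 1 = i") (simp_all add: continuous_on_Wentry continuous_on_Wcol)
  then show ?thesis unfolding Wimat_def by (intro continuous_on_det_mat)
qed

theorem theorem6p4:
  fixes \<gamma> :: complex and L :: nat and \<mu> x :: "nat \<Rightarrow> complex" and i :: nat
  assumes "1 \<le> L"
    and "1 \<le> i" and "i \<le> L"
    and generic_x: "\<forall>\<alpha>\<in>{0..L}. \<forall>\<beta>\<in>{0..L}. \<alpha> \<noteq> \<beta> \<longrightarrow> wb (x \<alpha> - x \<beta>) \<noteq> 0"
    and generic_mu: "\<forall>k\<in>{1..L}. wb (x 0 - \<mu> k) \<noteq> 0"
  shows "Zdw \<gamma> \<mu> L x = det (Wmat \<gamma> \<mu> L x) * (\<Prod>k\<in>{1..L}. wb (x 0 - x k) / wb (x 0 - \<mu> k))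
       \<and> Zdw \<gamma> \<mu> L (x(i := x 0)) = det (Wimat \<gamma> \<mu> L x i) * (\<Prod>k\<in>{1..L}. wb (x 0 - x k) / wb (x 0 - \<mu> k))"
proof -
  let ?P = "\<Prod>k\<in>{1..L}. wb (x 0 - x k) / wb (x 0 - \<mu> k)"
  \<comment> \<open>a(x_\<alpha> - x_\<beta>) = sinh(\<gamma> - d) for d = x_\<beta> - x_\<alpha>.
    The pairs with \<alpha> = \<beta> give d = 0, which also excludes sinh \<gamma> = 0.\<close>
  let ?bad = "(\<lambda>(\<alpha>, \<beta>). x \<beta> - x \<alpha>) ` ({0..L} \<times> {0..L})"
  have points: "dwpf_points \<delta> x L \<mu>" if \<delta>: "\<forall>d\<in>?bad. sinh (\<delta> - d) \<noteq> 0" for \<delta>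
  proof
    have wa: "wa \<delta> (x \<alpha> - x \<beta>) \<noteq> 0" if "\<alpha> \<in> {0..L}" "\<beta> \<in> {0..L}" for \<alpha> \<beta>
      using \<delta> that by (force simp: wa_def algebra_simps)
    then show "wa \<delta> (x \<alpha> - x \<beta>) \<noteq> 0" if "\<alpha> \<in> {0..L}" "\<beta> \<in> {0..L}" for \<alpha> \<beta>
      using that by simp
    show "sinh \<delta> \<noteq> 0" using wa[of 0 0] by (simp add: wa_def)
  qed (use generic_x generic_mu in auto)
  have 1: "Zdw \<gamma> \<mu> L x - det (Wmat \<gamma> \<mu> L x) * ?P = 0"
  proof (rule continuous_eq_0_of_generic[where D = ?bad and
        f = "\<lambda>\<gamma>. Zdw \<gamma> \<mu> L x - det (Wmat \<gamma> \<mu> L x) * ?P"])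
    show "continuous_on UNIV (\<lambda>\<gamma>. Zdw \<gamma> \<mu> L x - det (Wmat \<gamma> \<mu> L x) * ?P)"
      by (intro continuous_intros continuous_on_Zdw continuous_on_det_Wmat)
    show "Zdw \<delta> \<mu> L x - det (Wmat \<delta> \<mu> L x) * ?P = 0" if "\<forall>d\<in>?bad. sinh (\<delta> - d) \<noteq> 0" for \<delta>
      using dwpf_points.Zdw_eq_det_Wmat[OF points[OF that]] by simp
  qed simp
  have 2: "Zdw \<gamma> \<mu> L (x(i := x 0)) - det (Wimat \<gamma> \<mu> L x i) * ?P = 0"
  proof (rule continuous_eq_0_of_generic[where D = ?bad and
        f = "\<lambda>\<gamma>. Zdw \<gamma> \<mu> L (x(i := x 0)) - det (Wimat \<gamma> \<mu> L x i) * ?P"])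
    show "continuous_on UNIV (\<lambda>\<gamma>. Zdw \<gamma> \<mu> L (x(i := x 0)) - det (Wimat \<gamma> \<mu> L x i) * ?P)"
      by (intro continuous_intros continuous_on_Zdw continuous_on_det_Wimat)
    show "Zdw \<delta> \<mu> L (x(i := x 0)) - det (Wimat \<delta> \<mu> L x i) * ?P = 0" if "\<forall>d\<in>?bad. sinh (\<delta> - d) \<noteq> 0" for \<delta>
      using dwpf_points.Zdw_upd_eq_det_Wimat[OF points[OF that] assms(2,3)] by simp
  qed simp
  show ?thesis using 1 2 by simp
qed

end
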